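(* Let $k$ be a positive even integer, let $n_0=C^{2k-3}_{k-2}$, and let $C_{\mathcal{L}_k^{truc}}$ and $C_{\mathcal{M}_k^{truc}}$ be the $[2n_0,n_0]$ binary codes defined in the context. Then there are real numbers $a_i$ such that $$W_{C_{\mathcal{L}_k^{truc}}}(x,y)=W_{C_{\mathcal{M}_k^{truc}}}(x,y)=\sum_{i=0}^{\lfloor n_0/4\rfloor}a_i\,g_1(x,y)^{n_0-4i}g_2(x,y)^i,$$ where $g_1(x,y)=y^2+x^2$ and $g_2(x,y)=y^8+14x^4y^4+x^8$ are the Gleason polynomials. Moreover $$d_{C_{\mathcal{L}_k^{truc}}}=d_{C_{\mathcal{M}_k^{truc}}}\le\begin{cases}2\lfloor n_0/4\rfloor+2&\text{if }n_0\le30,\\ 2\lfloor n_0/4\rfloor&\text{if }n_0\ge32.\end{cases}$$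
   Context: $C^a_b$ denotes the binomial coefficient. $I_p$ is the $p\times p$ identity matrix and $J_p$ is the $p\times p$ all-ones matrix minus $I_p$. If $X$ has $m$ columns and $Y$ is $m\times m$, $X(Y)$ denotes the matrix obtained by pasting $Y$ below $X$. $X\sqcup_0Y$ (resp. $X\sqcup_1Y$) is obtained by placing $Y$ to the right of $X$ with bottom rows aligned and filling the remaining upper right block with zeros (resp. ones), iterated from left to right. For $h\ge1$: $A_h^{-1}$ is the $1\times h$ row of ones, $B_h^{-1}$ is the $1\times h$ row of zeros, and for $j\ge0$, $A_h^{j}=A_h^{j-1}(I_{C^{h+j}_{j+1}})\sqcup_0 A_{h-1}^{j-1}(I_{C^{h-1+j}_{j+1}})\sqcup_0\cdots\sqcup_0A_1^{j-1}(I_{C^{1+j}_{j+1}})$ and $B_h^{j}=B_h^{j-1}(J_{C^{h+j}_{j+1}})\sqcup_1 B_{h-1}^{j-1}(J_{C^{h-1+j}_{j+1}})\sqcup_1\cdots\sqcup_1B_1^{j-1}(J_{C^{1+j}_{j+1}})$. The matrices $A_{k-1}^{k-3}$ and $B_{k-1}^{k-3}$ are square of order $n_0$. Define $\mathcal{L}_k^{truc}=(I_{n_0}\,|\,A_{k-1}^{k-3})$ and $\mathcal{M}_k^{truc}=(J_{n_0}\,|\,B_{k-1}^{k-3})$, read over $\mathbb{F}_2$; $C_{\mathcal{L}_k^{truc}}$ and $C_{\mathcal{M}_k^{truc}}$ are the binary codes generated by these matrices. For a binary code $C$ of length $N$, $W_C(x,y)=\sum_{c\in C}x^{\mathrm{wt}(c)}y^{N-\mathrm{wt}(c)}$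 is its weight enumerator and $d_C$ its minimum distance.
   Formalization: For k=2 the claims about the code of M_k^truc are dropped: there n_0=1 and M=(0|0) generates the zero code, with W_M=y^2 different from W_L=x^2+y^2 and no minimum distance; the claims about the code of L_k^truc are kept for every positive even k. *)

theory Defs
  imports "HOL-Library.Z2" "Jordan_Normal_Form.VS_Connect"
begin

definition append_cols :: "'a::zero mat \<Rightarrow> 'a mat \<Rightarrow> 'a mat" where
  "append_cols X Y = four_block_mat X Y (0\<^sub>m 0 (dim_col X)) (0\<^sub>m 0 (dim_col Y))"

definition J_mat :: "nat \<Rightarrow> bit mat" where
  "J_mat p = mat p p (\<lambda>_. 1) - 1\<^sub>m p"

text \<open>\<open>glue e X Y\<close> is the matrix written \<open>X \<squnion>\<^sub>e Y\<close>, for \<open>Y\<close> with at most as many rows as \<open>X\<close>.\<close>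

definition glue :: "bit \<Rightarrow> bit mat \<Rightarrow> bit mat \<Rightarrow> bit mat" where
  "glue e X Y = append_cols X (mat (dim_row X - dim_row Y) (dim_col Y) (\<lambda>_. e) @\<^sub>r Y)"

fun glue_list :: "bit \<Rightarrow> bit mat list \<Rightarrow> bit mat" where
  "glue_list e [] = 0\<^sub>m 0 0"
| "glue_list e (X # Xs) = foldl (glue e) X Xs"

text \<open>
  The upper index is shifted by one, because it starts at \<open>-1\<close>: \<open>A_mat h m\<close> is the matrix
  \<open>A\<^sub>h\<^sup>j\<close> with \<open>j = m - 1\<close>, and likewise for \<open>B_mat\<close>. The glued blocks have the indices
  \<open>i = h, h - 1, \<dots>, 1\<close> from left to right. Only \<open>h \<ge> 1\<close> is meaningful.
\<close>

fun A_mat :: "nat \<Rightarrow> nat \<Rightarrow> bit mat" where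
  "A_mat h 0 = mat 1 h (\<lambda>_. 1)"
| "A_mat h (Suc j) =
     glue_list 0 (map (\<lambda>i. A_mat i j @\<^sub>r 1\<^sub>m ((i + j) choose (j + 1))) (rev [1..<Suc h]))"

fun B_mat :: "nat \<Rightarrow> nat \<Rightarrow> bit mat" where
  "B_mat h 0 = mat 1 h (\<lambda>_. 0)"
| "B_mat h (Suc j) =
     glue_list 1 (map (\<lambda>i. B_mat i j @\<^sub>r J_mat ((i + j) choose (j + 1))) (rev [1..<Suc h]))"

definition n0 :: "nat \<Rightarrow> nat" where
  "n0 k = (2 * k - 3) choose (k - 2)"

text \<open>For \<open>k \<ge> 2\<close>, \<open>A_mat (k - 1) (k - 2)\<close> is \<open>A\<^bsub>k-1\<^esub>\<^bsup>k-3\<^esup>\<close>.\<close>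

definition L_truc :: "nat \<Rightarrow> bit mat" where
  "L_truc k = append_cols (1\<^sub>m (n0 k)) (A_mat (k - 1) (k - 2))"

definition M_truc :: "nat \<Rightarrow> bit mat" where
  "M_truc k = append_cols (J_mat (n0 k)) (B_mat (k - 1) (k - 2))"

definition code_of :: "bit mat \<Rightarrow> bit vec set" where
  "code_of G = vec_space.row_space (dim_col G) G"

definition linear_code :: "nat \<Rightarrow> nat \<Rightarrow> bit vec set \<Rightarrow> bool" where
  "linear_code N K C \<longleftrightarrow>
     VectorSpace.subspace class_ring C (module_vec TYPE(bit) N) \<and>
     vectorspace.dim class_ring ((module_vec TYPE(bit) N)\<lparr>carrier := C\<rparr>) = K"

definition hamming_weight :: "bit vec \<Rightarrow> nat" where
  "hamming_weight c = card {i. i < dim_vec c \<and> c $ i \<noteq> 0}"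

definition hamming_dist :: "bit vec \<Rightarrow> bit vec \<Rightarrow> nat" where
  "hamming_dist u v = card {i. i < dim_vec u \<and> u $ i \<noteq> v $ i}"

text \<open>Meaningful only for codes with at least two words.\<close>

definition min_dist :: "bit vec set \<Rightarrow> nat" where
  "min_dist C = Inf {hamming_dist u v | u v. u \<in> C \<and> v \<in> C \<and> u \<noteq> v}"

text \<open>
  Weight enumerators and Gleason polynomials are given by their values; an identity for all
  real \<open>x\<close>, \<open>y\<close> is the identity of the polynomials (recall \<open>0 ^ 0 = 1\<close>).
\<close>

definition weight_enum :: "nat \<Rightarrow> bit vec set \<Rightarrow> real \<Rightarrow> real \<Rightarrow> real" where
  "weight_enum N C x y = (\<Sum>c\<in>C. x ^ hamming_weight c * y ^ (N - hamming_weight c))"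

definition gleason1 :: "real \<Rightarrow> real \<Rightarrow> real" where
  "gleason1 x y = y ^ 2 + x ^ 2"

definition gleason2 :: "real \<Rightarrow> real \<Rightarrow> real" where
  "gleason2 x y = y ^ 8 + 14 * x ^ 4 * y ^ 4 + x ^ 8"

end

(* The recursion for A_h^j is the lexicographic recursion for inclusion matrices: the rows of
   A_h^j are the (j+1)-subsets of an (h+j+1)-set, its columns the (j+2)-subsets, split according
   to whether they contain a chosen point. For h = k-1, j = k-3 the ground set has 2k-3 points, so
   complementation carries the matrix to its transpose. Hence the code L = (I | A) is equivalent to
   its dual (though in general not equal to it), and its weight enumerator is fixed by the
   MacWilliams transform. Rows of L have weight k, so all weights are even. In the coordinate
   z = y + ix, invariance under x -> -x and under the transform means invariance under the dihedral
   group of order 16, and averaging over the group leaves only (z w)^(n-4j) Re z^(8j) with w = y - ix, a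
   polynomial in g_1 = z w and g_2 by the three-term recursion for Re z^(8j).

   B is the complement of A, so M is L plus the all-ones matrix. The columns of L have odd weight,
   so the all-ones word is the sum of the rows of L, and as n_0 is even for k > 2 the two row
   spaces coincide. The distance bound is far from sharp: a row of L has weight only k. *)

theory Submission
  imports Defs Complex_Main "HOL-Number_Theory.Cong" "Jordan_Normal_Form.DL_Rank"
begin

section \<open>Inclusion matrices\<close>

text \<open>Lists the \<open>m\<close>-subsets of \<open>{..<n}\<close>, those with the largest
  point first. Blocks are glued in the same order, so the recursive matrices agree with inclusion
  matrices entry by entry and not only up to permutation.\<close>

fun subs :: "nat \<Rightarrow> nat \<Rightarrow> nat set list" where
  "subs 0 n = [{}]"
| "subs (Suc m) 0 = []"
| "subs (Suc m) (Suc n) = map (insert n) (subs m n) @ subs (Suc m) n"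

lemma length_subs [simp]: "length (subs m n) = n choose m"
  by (induction m n rule: subs.induct) auto

lemma set_subs: "set (subs m n) = {S. S \<subseteq> {..<n} \<and> card S = m}"
proof (induction m n rule: subs.induct)
  case (1 n)
  show ?case using finite_subset[of _ "{..<n}"] by auto
next
  case (2 m)
  show ?case by auto
next
  case (3 m n)
  have "S \<in> insert n ` {S. S \<subseteq> {..<n} \<and> card S = m}"
    if S: "S \<subseteq> {..<Suc n}" "card S = Suc m" "n \<in> S" for S
  proof
    show "S = insert n (S - {n})" using S by auto
    show "S - {n} \<in> {S. S \<subseteq> {..<n} \<and> card S = m}" using S by (auto simp: less_Suc_eq)
  qed
  moreover have "card (insert n S) = Suc (card S)" if "S \<subseteq> {..<n}" for S
    using that finite_subset[of S "{..<n}"] by (subst card_insert_disjoint) auto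
  moreover have "S \<subseteq> {..<n}" if "S \<subseteq> {..<Suc n}" "n \<notin> S" for S
    using that by (auto simp: less_Suc_eq)
  ultimately show ?case
    by (auto simp: 3 less_Suc_eq)
qed

lemma distinct_subs: "distinct (subs m n)"
proof (induction m n rule: subs.induct)
  case (3 m n)
  have "inj_on (insert n) (set (subs m n))"
    by (auto simp: set_subs inj_on_def)
  with 3 show ?case by (auto simp: distinct_map set_subs)
qed auto

lemma nth_subs: "i < n choose m \<Longrightarrow> subs m n ! i \<subseteq> {..<n} \<and> card (subs m n ! i) = m"
  using nth_mem[of i "subs m n"] by (auto simp: set_subs)

text \<open>The bit \<open>e\<close> treats both families at once: \<open>e = 0\<close> gives the
  inclusion matrix of \<open>m\<close>-subsets in \<open>Suc m\<close>-subsets, \<open>e = 1\<close>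
  its complement over F_2.\<close>

definition incl_mat :: "bit \<Rightarrow> nat \<Rightarrow> nat \<Rightarrow> bit mat" where
  "incl_mat e m n = mat (n choose m) (n choose Suc m)
     (\<lambda>(i, j). e + of_bool (subs m n ! i \<subseteq> subs (Suc m) n ! j))"

lemma dim_incl_mat [simp]:
  "dim_row (incl_mat e m n) = n choose m" "dim_col (incl_mat e m n) = n choose Suc m"
  by (simp_all add: incl_mat_def)

definition diag_mat_plus :: "bit \<Rightarrow> nat \<Rightarrow> bit mat" where
  "diag_mat_plus e p = mat p p (\<lambda>(i, j). e + of_bool (i = j))"

lemma diag_mat_plus_0: "diag_mat_plus 0 p = 1\<^sub>m p"
  by (auto simp: diag_mat_plus_def)

lemma diag_mat_plus_1: "diag_mat_plus 1 p = J_mat p"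
  by (auto simp: diag_mat_plus_def J_mat_def)

lemma dim_diag_mat_plus [simp]: "dim_row (diag_mat_plus e p) = p" "dim_col (diag_mat_plus e p) = p"
  by (simp_all add: diag_mat_plus_def)

section \<open>Entries and associativity of glued blocks\<close>

lemma dim_append_rows [simp]:
  "dim_row (X @\<^sub>r Y) = dim_row X + dim_row Y" "dim_col (X @\<^sub>r Y) = dim_col X"
  by (simp_all add: append_rows_def)

lemma index_append_rows:
  "i < dim_row X + dim_row Y \<Longrightarrow> j < dim_col X \<Longrightarrow>
   (X @\<^sub>r Y) $$ (i, j) = (if i < dim_row X then X $$ (i, j) else Y $$ (i - dim_row X, j))"
  by (simp add: append_rows_def)

lemma dim_append_cols [simp]:
  "dim_row (append_cols X Y) = dim_row X" "dim_col (append_cols X Y) = dim_col X + dim_col Y"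
  by (simp_all add: append_cols_def)

lemma index_append_cols:
  "i < dim_row X \<Longrightarrow> j < dim_col X + dim_col Y \<Longrightarrow>
   append_cols X Y $$ (i, j) = (if j < dim_col X then X $$ (i, j) else Y $$ (i, j - dim_col X))"
  by (simp add: append_cols_def)

lemma dim_glue [simp]:
  "dim_row (glue e X Y) = dim_row X" "dim_col (glue e X Y) = dim_col X + dim_col Y"
  by (simp_all add: glue_def)

lemma index_glue:
  assumes "dim_row Y \<le> dim_row X" "i < dim_row X" "j < dim_col X + dim_col Y"
  shows "glue e X Y $$ (i, j) =
    (if j < dim_col X then X $$ (i, j)
     else if i < dim_row X - dim_row Y then e
     else Y $$ (i - (dim_row X - dim_row Y), j - dim_col X))"
  using assms by (auto simp: glue_def index_append_cols index_append_rows)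

text \<open>Bottom rows are aligned and every free cell above a block is \<open>e\<close>, however
  the gluing is bracketed. This is needed because \<open>glue_list\<close> folds from the left,
  while the induction on the number of blocks peels off the leftmost one.\<close>

lemma glue_assoc:
  assumes "dim_row Y \<le> dim_row X" "dim_row Z \<le> dim_row Y"
  shows "glue e (glue e X Y) Z = glue e X (glue e Y Z)" (is "?L = ?R")
proof (rule eq_matI)
  fix i j assume "i < dim_row ?R" "j < dim_col ?R"
  then have ij: "i < dim_row X" "j < dim_col X + (dim_col Y + dim_col Z)" by simp_all
  \<comment> \<open>The filler heights \<open>p\<close> and \<open>q\<close> replace truncated
    subtraction by addition.\<close>
  obtain p q where p: "dim_row X = dim_row Y + p" and q: "dim_row Y = dim_row Z + q"
    using assms by (metis le_Suc_ex)
  have L: "?L $$ (i, j) =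
      (if j < dim_col X + dim_col Y then glue e X Y $$ (i, j)
       else if i < p + q then e else Z $$ (i - (p + q), j - (dim_col X + dim_col Y)))"
    using ij by (subst index_glue) (simp_all add: p q add.commute)
  have R: "?R $$ (i, j) =
      (if j < dim_col X then X $$ (i, j)
       else if i < p then e else glue e Y Z $$ (i - p, j - dim_col X))"
    using ij by (subst index_glue) (simp_all add: p)
  show "?L $$ (i, j) = ?R $$ (i, j)"
  proof (cases "j < dim_col X + dim_col Y")
    case True
    then have "\<not> j < dim_col X \<Longrightarrow> j - dim_col X < dim_col Y" by linarith
    with True show ?thesis unfolding L R using ij by (simp add: index_glue p q)
  next
    case False
    show ?thesis
    proof (cases "i < p")
      case True
      then show ?thesis unfolding L R using False by simp
    next
      case i: False
      have "glue e Y Z $$ (i - p, j - dim_col X) =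
          (if i < p + q then e else Z $$ (i - (p + q), j - (dim_col X + dim_col Y)))"
        using False i ij by (subst index_glue) (auto simp: p q less_diff_conv2)
      then show ?thesis unfolding L R using False i by simp
    qed
  qed
qed simp_all

lemma glue_foldl:
  assumes "sorted_wrt (\<lambda>X Y. dim_row Y \<le> dim_row X) (X # Y # Ys)"
  shows "foldl (glue e) (glue e X Y) Ys = glue e X (foldl (glue e) Y Ys)"
  using assms
proof (induction Ys arbitrary: Y)
  case (Cons Z Ys)
  then show ?case by (simp add: glue_assoc)
qed simp

lemma glue_empty:
  assumes "dim_col Y = 0" "dim_row Y \<le> dim_row X"
  shows "glue e X Y = X"
  using assms by (intro eq_matI) (auto simp: index_glue)

text \<open>Pascal's rule for inclusion: rows \<open>S\<close> and columns \<open>T\<close> are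
  split by whether they contain the point \<open>n\<close>. If both do, \<open>n\<close> can be
  removed from both; if only \<open>S\<close> does, inclusion fails and the entry is
  \<open>e\<close>; if only \<open>T\<close> does, \<open>S\<close> and \<open>T - {n}\<close> have
  equal size, so inclusion means equality and gives the diagonal block; if neither does, the point
  \<open>n\<close> is irrelevant.\<close>

lemma glue_incl_mat:
  "glue e (incl_mat e m n @\<^sub>r diag_mat_plus e (n choose Suc m)) (incl_mat e (Suc m) n)
     = incl_mat e (Suc m) (Suc n)" (is "?L = ?R")
proof (rule eq_matI)
  fix i j assume "i < dim_row ?R" "j < dim_col ?R"
  then have i: "i < (n choose m) + (n choose Suc m)"
    and j: "j < (n choose Suc m) + (n choose Suc (Suc m))" by simp_all
  have mem: "subs a n ! t \<subseteq> {..<n}" "n \<notin> subs a n ! t" "card (subs a n ! t) = a"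
    if "t < n choose a" for t a
    using nth_subs[OF that] by auto
  have rng: "subs (Suc m) (Suc n) ! i =
      (if i < n choose m then insert n (subs m n ! i) else subs (Suc m) n ! (i - (n choose m)))"
    using i by (auto simp: nth_append)
  have cng: "subs (Suc (Suc m)) (Suc n) ! j =
      (if j < n choose Suc m then insert n (subs (Suc m) n ! j)
       else subs (Suc (Suc m)) n ! (j - (n choose Suc m)))"
    using j by (auto simp: nth_append)
  have R: "?R $$ (i, j) = e + of_bool (subs (Suc m) (Suc n) ! i \<subseteq> subs (Suc (Suc m)) (Suc n) ! j)"
    using i j by (simp add: incl_mat_def del: subs.simps)
  have L: "?L $$ (i, j) =
      (if j < n choose Suc m then
         (if i < n choose m then incl_mat e m n $$ (i, j)
          else diag_mat_plus e (n choose Suc m) $$ (i - (n choose m), j))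
       else if i < n choose m then e
       else incl_mat e (Suc m) n $$ (i - (n choose m), j - (n choose Suc m)))"
    using i j by (subst index_glue) (auto simp: index_append_rows)
  consider (a) "i < n choose m" "j < n choose Suc m"
    | (b) "i < n choose m" "\<not> j < n choose Suc m"
    | (c) "\<not> i < n choose m" "j < n choose Suc m"
    | (d) "\<not> i < n choose m" "\<not> j < n choose Suc m" by blast
  then show "?L $$ (i, j) = ?R $$ (i, j)"
  proof cases
    case a
    then show ?thesis unfolding L R rng cng using mem(2)[of i m]
      by (auto simp: incl_mat_def)
  next
    case b
    then show ?thesis unfolding L R rng cng using mem(2)[of "j - (n choose Suc m)" "Suc (Suc m)"] j
      by auto
  next
    case c
    define i' where "i' = i - (n choose m)"
    have i': "i' < n choose Suc m" using i c by (simp add: i'_def)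
    have "subs (Suc m) n ! i' \<subseteq> insert n (subs (Suc m) n ! j)
        \<longleftrightarrow> subs (Suc m) n ! i' \<subseteq> subs (Suc m) n ! j"
      using mem(2)[OF i'] by auto
    also have "\<dots> \<longleftrightarrow> subs (Suc m) n ! i' = subs (Suc m) n ! j"
      using mem[OF i'] mem[OF c(2)] by (metis card_subset_eq finite_lessThan finite_subset order_refl)
    also have "\<dots> \<longleftrightarrow> i' = j"
      using i' c(2) by (simp add: nth_eq_iff_index_eq distinct_subs)
    finally show ?thesis unfolding L R rng cng using c i'
      by (simp add: diag_mat_plus_def flip: i'_def)
  next
    case d
    then show ?thesis unfolding L R rng cng using i j by (simp add: incl_mat_def)
  qed
qed auto

text \<open>Each block is the left part of one Pascal split, and the blocks to its right assemble to
  the right part, with one point fewer.\<close>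

lemma glue_list_incl_mat:
  assumes "0 < h"
  shows "glue_list e (map (\<lambda>i. incl_mat e m (i + m) @\<^sub>r diag_mat_plus e ((i + m) choose Suc m))
           (rev [1..<Suc h])) = incl_mat e (Suc m) (h + Suc m)"
    (is "glue_list e (map ?F _) = _")
  using assms
proof (induction h rule: nat_induct_non_zero)
  case 1
  \<comment> \<open>A set of \<open>m + 1\<close> points has no subsets of size
    \<open>m + 2\<close>, so the right part has no columns.\<close>
  have "?F 1 = glue e (?F 1) (incl_mat e (Suc m) (1 + m))"
    by (rule glue_empty[symmetric]) auto
  also have "\<dots> = incl_mat e (Suc m) (1 + Suc m)"
    using glue_incl_mat[of e m "1 + m"] by simp
  finally show ?case by simp
next
  case (Suc h)
  \<comment> \<open>Associativity requires heights that do not increase from left to right; by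
    Pascal's rule block \<open>i\<close> has \<open>(i + Suc m) choose Suc m\<close> rows.\<close>
  have mono: "dim_row (?F x) \<le> dim_row (?F y)" if "x < y" for x y
  proof -
    have "dim_row (?F i) = (i + Suc m) choose Suc m" for i by simp
    then show ?thesis using that by (metis add_le_mono1 binomial_right_mono less_imp_le)
  qed
  have sorted: "sorted_wrt (\<lambda>X Y. dim_row Y \<le> dim_row X) (map ?F (rev [1..<Suc (Suc h)]))"
    unfolding sorted_wrt_map sorted_wrt_rev
    by (rule sorted_wrt_mono_rel[OF _ sorted_wrt_upt]) (rule mono)
  obtain g where h: "h = Suc g" using Suc.hyps by (cases h) auto
  let ?Ys = "map ?F (rev [1..<h])"
  have eq: "map ?F (rev [1..<Suc h]) = ?F h # ?Ys"
    "map ?F (rev [1..<Suc (Suc h)]) = ?F (Suc h) # ?F h # ?Ys"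
    using h by (simp_all only: upt_Suc) auto
  have "glue_list e (map ?F (rev [1..<Suc (Suc h)])) = glue e (?F (Suc h)) (foldl (glue e) (?F h) ?Ys)"
    using glue_foldl sorted unfolding eq by (simp only: glue_list.simps foldl.simps)
  also have "foldl (glue e) (?F h) ?Ys = incl_mat e (Suc m) (Suc h + m)"
    using Suc.IH unfolding eq by simp
  finally show ?case using glue_incl_mat[of e m "Suc h + m"] by simp
qed

text \<open>Induction on the upper index by the Pascal split. For \<open>m = 0\<close> the only row
  belongs to the empty set, which lies in every singleton.\<close>

lemma A_mat_eq: "0 < h \<Longrightarrow> A_mat h m = incl_mat 0 m (h + m)"
proof (induction m arbitrary: h)
  case (Suc m)
  have "A_mat h (Suc m) = glue_list 0 (map (\<lambda>i. incl_mat 0 m (i + m) @\<^sub>r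
      diag_mat_plus 0 ((i + m) choose Suc m)) (rev [1..<Suc h]))"
    unfolding A_mat.simps
    by (intro arg_cong[where f = "glue_list 0"] map_cong) (auto simp: Suc.IH diag_mat_plus_0)
  then show ?case using glue_list_incl_mat[OF Suc.prems] by simp
qed (auto simp: incl_mat_def)

lemma B_mat_eq: "0 < h \<Longrightarrow> B_mat h m = incl_mat 1 m (h + m)"
proof (induction m arbitrary: h)
  case (Suc m)
  have "B_mat h (Suc m) = glue_list 1 (map (\<lambda>i. incl_mat 1 m (i + m) @\<^sub>r
      diag_mat_plus 1 ((i + m) choose Suc m)) (rev [1..<Suc h]))"
    unfolding B_mat.simps
    by (intro arg_cong[where f = "glue_list 1"] map_cong) (auto simp: Suc.IH diag_mat_plus_1)
  then show ?case using glue_list_incl_mat[OF Suc.prems] by simp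
qed (auto simp: incl_mat_def)

section \<open>The MacWilliams identity\<close>

text \<open>The nontrivial additive character of F_2, with real values.\<close>

definition chi :: "bit \<Rightarrow> real" where
  "chi b = (if b = 0 then 1 else - 1)"

lemma chi_0 [simp]: "chi 0 = 1" and chi_1 [simp]: "chi 1 = - 1"
  by (simp_all add: chi_def)

lemma chi_add: "chi (a + b) = chi a * chi b"
  by (cases a; cases b) simp_all

lemma chi_sum: "chi (sum f I) = (\<Prod>i\<in>I. chi (f i))"
  by (induction I rule: infinite_finite_induct) (simp_all only: sum.insert prod.insert sum.empty prod.empty sum.infinite prod.infinite chi_add chi_0 not_False_eq_True)

section \<open>Sums over all binary words\<close>

lemma UNIV_bit: "(UNIV :: bit set) = {0, 1}"
  by (auto intro: bit.exhaust)

lemma bij_betw_vec_PiE: "bij_betw (vec N :: (nat \<Rightarrow> 'a) \<Rightarrow> _) ({..<N} \<rightarrow>\<^sub>E UNIV) (carrier_vec N)"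
proof (rule bij_betw_byWitness[where f' = "\<lambda>v. restrict (\<lambda>i. v $ i) {..<N}"])
  show "\<forall>g\<in>{..<N} \<rightarrow>\<^sub>E (UNIV :: 'a set). restrict (\<lambda>i. vec N g $ i) {..<N} = g"
  proof
    fix g :: "nat \<Rightarrow> 'a" assume "g \<in> {..<N} \<rightarrow>\<^sub>E UNIV"
    then have "g = restrict g {..<N}" by (simp add: PiE_def extensional_restrict)
    moreover have "restrict (\<lambda>i. vec N g $ i) {..<N} = restrict g {..<N}"
      by (rule restrict_ext) simp
    ultimately show "restrict (\<lambda>i. vec N g $ i) {..<N} = g" by simp
  qed
  show "\<forall>v\<in>carrier_vec N. vec N (restrict (\<lambda>i. v $ i) {..<N}) = (v :: 'a vec)"
    by (intro ballI eq_vecI) simp_all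
  show "vec N ` ({..<N} \<rightarrow>\<^sub>E (UNIV :: 'a set)) \<subseteq> carrier_vec N"
    by (rule image_subsetI) simp
  show "(\<lambda>v. restrict (\<lambda>i. v $ i) {..<N}) ` carrier_vec N \<subseteq> {..<N} \<rightarrow>\<^sub>E (UNIV :: 'a set)"
    by (rule image_subsetI) (rule restrict_PiE_iff[THEN iffD2], simp)
qed

lemma finite_carrier_vec_bit: "finite (carrier_vec N :: bit vec set)"
proof -
  have "bij_betw (vec N) ({..<N} \<rightarrow>\<^sub>E (UNIV :: bit set)) (carrier_vec N)"
    by (rule bij_betw_vec_PiE)
  moreover have "finite ({..<N} \<rightarrow>\<^sub>E (UNIV :: bit set))"
    by (simp add: finite_PiE UNIV_bit)
  ultimately show ?thesis
    using bij_betw_finite by blast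
qed

lemma card_carrier_vec_bit: "card (carrier_vec N :: bit vec set) = 2 ^ N"
proof -
  have "bij_betw (vec N) ({..<N} \<rightarrow>\<^sub>E (UNIV :: bit set)) (carrier_vec N)"
    by (rule bij_betw_vec_PiE)
  then have "card (carrier_vec N :: bit vec set) = card ({..<N} \<rightarrow>\<^sub>E (UNIV :: bit set))"
    by (rule bij_betw_same_card[symmetric])
  then show ?thesis by (simp add: card_PiE UNIV_bit numeral_2_eq_2)
qed

text \<open>Expanding the product on the right chooses one bit per coordinate, that is, a
  word.\<close>

lemma sum_prod_carrier_vec_bit:
  fixes f :: "nat \<Rightarrow> bit \<Rightarrow> real"
  shows "(\<Sum>v\<in>carrier_vec N. \<Prod>i<N. f i (v $ i)) = (\<Prod>i<N. f i 0 + f i 1)"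
proof -
  have "(\<Sum>v\<in>carrier_vec N. \<Prod>i<N. f i (v $ i)) =
      (\<Sum>g\<in>{..<N} \<rightarrow>\<^sub>E UNIV. \<Prod>i<N. f i (vec N g $ i))"
    by (rule sum.reindex_bij_betw[OF bij_betw_vec_PiE, symmetric])
  also have "\<dots> = (\<Sum>g\<in>{..<N} \<rightarrow>\<^sub>E UNIV. \<Prod>i<N. f i (g i))"
    by (intro sum.cong prod.cong) auto
  also have "\<dots> = (\<Prod>i<N. \<Sum>b\<in>UNIV. f i b)"
    by (subst prod_sum_PiE) (auto simp: UNIV_bit)
  finally show ?thesis by (simp add: UNIV_bit)
qed

lemma hamming_weight_monomial:
  fixes x y :: real
  assumes "v \<in> carrier_vec N"
  shows "x ^ hamming_weight v * y ^ (N - hamming_weight v) = (\<Prod>i<N. if v $ i = 0 then y else x)"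
proof -
  have w: "hamming_weight v = card ({..<N} \<inter> - {i. v $ i = 0})"
    using assms by (auto simp: hamming_weight_def intro: arg_cong[where f = card])
  have "card ({..<N} \<inter> {i. v $ i = 0}) = N - hamming_weight v"
    using card_Diff_subset_Int[of "{..<N}" "{i. v $ i = 0}"] card_mono[of "{..<N}" "{..<N} \<inter> {i. v $ i = 0}"]
    by (simp add: w Diff_eq)
  then show ?thesis
    by (simp add: prod.If_cases w mult.commute)
qed

lemma hamming_weight_le: "v \<in> carrier_vec N \<Longrightarrow> hamming_weight v \<le> N"
  unfolding hamming_weight_def
  using card_mono[of "{..<N}" "{i. i < dim_vec v \<and> v $ i \<noteq> 0}"] by auto

definition dual_code :: "nat \<Rightarrow> bit vec set \<Rightarrow> bit vec set" where
  "dual_code N C = {v \<in> carrier_vec N. \<forall>u\<in>C. u \<bullet> v = 0}"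

text \<open>Orthogonality of characters: if some \<open>w\<close> in \<open>C\<close> has
  \<open>w \<bullet> v = 1\<close>, translation by \<open>w\<close> permutes \<open>C\<close> and
  flips the sign of every term, so the sum equals its own negative.\<close>

lemma sum_chi_scalar_prod:
  assumes C: "C \<subseteq> carrier_vec N" and add: "\<And>u v. u \<in> C \<Longrightarrow> v \<in> C \<Longrightarrow> u + v \<in> C"
    and v: "v \<in> carrier_vec N"
  shows "(\<Sum>u\<in>C. chi (u \<bullet> v)) = (if v \<in> dual_code N C then real (card C) else 0)"
proof (cases "v \<in> dual_code N C")
  case True
  then show ?thesis by (simp add: dual_code_def)
next
  case False
  then obtain w where w: "w \<in> C" "w \<bullet> v = 1"
    using v by (auto simp: dual_code_def)
  have cancel: "w + (w + u) = u" if "u \<in> C" for u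
  proof (rule eq_vecI)
    have dims: "dim_vec w = N" "dim_vec u = N" using that w C by auto
    fix i assume "i < dim_vec u"
    then show "(w + (w + u)) $ i = u $ i"
      using dims by (cases "w $ i"; cases "u $ i") simp_all
  qed (use that w C in auto)
  have "bij_betw (\<lambda>u. w + u) C C"
    by (rule bij_betw_byWitness[where f' = "\<lambda>u. w + u"]) (use cancel add w in auto)
  then have "(\<Sum>u\<in>C. chi (u \<bullet> v)) = (\<Sum>u\<in>C. chi ((w + u) \<bullet> v))"
    by (rule sum.reindex_bij_betw[symmetric])
  also have "\<dots> = (\<Sum>u\<in>C. - chi (u \<bullet> v))"
    using C w v by (intro sum.cong refl) (auto simp: add_scalar_prod_distrib[where n = N] chi_add subset_eq)
  finally show ?thesis using False by (simp add: sum_negf)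
qed

text \<open>The double sum of \<open>chi (u \<bullet> v) * m v\<close> over \<open>u\<close> in
  \<open>C\<close> and all words \<open>v\<close> is evaluated in both orders. Summing over
  \<open>v\<close> first transforms the monomial of \<open>u\<close>; summing over \<open>u\<close>
  first leaves only the dual code.\<close>

theorem macwilliams:
  assumes C: "C \<subseteq> carrier_vec N" and add: "\<And>u v. u \<in> C \<Longrightarrow> v \<in> C \<Longrightarrow> u + v \<in> C"
  shows "weight_enum N C (y - x) (y + x) = real (card C) * weight_enum N (dual_code N C) x y"
proof -
  define m where "m = (\<lambda>v :: bit vec. x ^ hamming_weight v * y ^ (N - hamming_weight v))"
  have transform: "(\<Sum>v\<in>carrier_vec N. chi (u \<bullet> v) * m v) =
      (y - x) ^ hamming_weight u * (y + x) ^ (N - hamming_weight u)" if u: "u \<in> carrier_vec N" for u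
  proof -
    have "(\<Sum>v\<in>carrier_vec N. chi (u \<bullet> v) * m v) =
        (\<Sum>v\<in>carrier_vec N. \<Prod>i<N. chi (u $ i * v $ i) * (if v $ i = 0 then y else x))"
    proof (intro sum.cong refl)
      fix v :: "bit vec" assume v: "v \<in> carrier_vec N"
      have "u \<bullet> v = (\<Sum>i<N. u $ i * v $ i)"
        unfolding scalar_prod_def using v by (simp only: carrier_vecD atLeast0LessThan)
      then show "chi (u \<bullet> v) * m v = (\<Prod>i<N. chi (u $ i * v $ i) * (if v $ i = 0 then y else x))"
        unfolding m_def hamming_weight_monomial[OF v] by (simp only: chi_sum prod.distrib)
    qed
    \<comment> \<open>The sum factors: coordinate \<open>i\<close> contributes \<open>y + x\<close>
      when \<open>u $ i\<close> is 0 and \<open>y - x\<close> when it is 1.\<close>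
    also have "\<dots> = (\<Prod>i<N. if u $ i = 0 then y + x else y - x)"
      by (subst sum_prod_carrier_vec_bit) (auto intro!: prod.cong)
    finally show ?thesis by (simp add: hamming_weight_monomial[OF u])
  qed
  have "weight_enum N C (y - x) (y + x) = (\<Sum>u\<in>C. \<Sum>v\<in>carrier_vec N. chi (u \<bullet> v) * m v)"
    unfolding weight_enum_def using C by (intro sum.cong) (auto simp: transform)
  also have "\<dots> = (\<Sum>v\<in>carrier_vec N. (\<Sum>u\<in>C. chi (u \<bullet> v)) * m v)"
    by (subst sum.swap) (simp add: sum_distrib_right)
  also have "\<dots> = (\<Sum>v\<in>carrier_vec N. if v \<in> dual_code N C then real (card C) * m v else 0)"
    by (intro sum.cong refl) (simp add: sum_chi_scalar_prod[OF C add])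
  also have "\<dots> = (\<Sum>v\<in>dual_code N C. real (card C) * m v)"
    by (rule sum.mono_neutral_cong_right) (use finite_carrier_vec_bit in \<open>auto simp: dual_code_def\<close>)
  finally show ?thesis by (simp add: weight_enum_def m_def sum_distrib_left)
qed

section \<open>Gleason polynomials\<close>

text \<open>The real span of the products of Gleason polynomials that have degree
  \<open>2 * n\<close>. The parameter is half the degree, which for the codes below is their
  dimension.\<close>

definition gleason_poly :: "nat \<Rightarrow> (real \<Rightarrow> real \<Rightarrow> real) \<Rightarrow> bool" where
  "gleason_poly n f \<longleftrightarrow> (\<exists>a :: nat \<Rightarrow> real. \<forall>x y.
     f x y = (\<Sum>i = 0..n div 4. a i * gleason1 x y ^ (n - 4 * i) * gleason2 x y ^ i))"

section \<open>Closure properties of the span of Gleason products\<close>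

lemma gleason_poly_zero: "gleason_poly n (\<lambda>x y. 0)"
  unfolding gleason_poly_def by (rule exI[of _ "\<lambda>_. 0"]) simp

lemma gleason_poly_one: "gleason_poly 0 (\<lambda>x y. 1)"
  unfolding gleason_poly_def by (rule exI[of _ "\<lambda>_. 1"]) simp

lemma gleason_poly_add:
  assumes "gleason_poly n f" "gleason_poly n g"
  shows "gleason_poly n (\<lambda>x y. f x y + g x y)"
proof -
  from assms obtain a b where
    "\<forall>x y. f x y = (\<Sum>i = 0..n div 4. a i * gleason1 x y ^ (n - 4 * i) * gleason2 x y ^ i)"
    "\<forall>x y. g x y = (\<Sum>i = 0..n div 4. b i * gleason1 x y ^ (n - 4 * i) * gleason2 x y ^ i)"
    unfolding gleason_poly_def by blast
  then show ?thesis unfolding gleason_poly_def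
    by (intro exI[of _ "\<lambda>i. a i + b i"]) (simp add: sum.distrib distrib_right)
qed

lemma gleason_poly_scale:
  assumes "gleason_poly n f"
  shows "gleason_poly n (\<lambda>x y. c * f x y)"
proof -
  from assms obtain a where
    "\<forall>x y. f x y = (\<Sum>i = 0..n div 4. a i * gleason1 x y ^ (n - 4 * i) * gleason2 x y ^ i)"
    unfolding gleason_poly_def by blast
  then show ?thesis unfolding gleason_poly_def
    by (intro exI[of _ "\<lambda>i. c * a i"]) (simp add: sum_distrib_left mult.assoc)
qed

lemma gleason_poly_sum:
  assumes "\<And>i. i \<in> I \<Longrightarrow> gleason_poly n (f i)"
  shows "gleason_poly n (\<lambda>x y. \<Sum>i\<in>I. f i x y)"
  using assms
  by (induction I rule: infinite_finite_induct)
     (simp_all add: gleason_poly_zero gleason_poly_add)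

lemma gleason_poly_mult1:
  assumes "gleason_poly n f"
  shows "gleason_poly (n + k) (\<lambda>x y. gleason1 x y ^ k * f x y)"
proof -
  from assms obtain a where a:
    "\<And>x y. f x y = (\<Sum>i = 0..n div 4. a i * gleason1 x y ^ (n - 4 * i) * gleason2 x y ^ i)"
    unfolding gleason_poly_def by blast
  \<comment> \<open>The range of \<open>i\<close> may grow with \<open>n\<close>; the coefficients
    beyond the old range are zero.\<close>
  let ?b = "\<lambda>i. if i \<le> n div 4 then a i else 0"
  have "gleason1 x y ^ k * f x y =
      (\<Sum>i = 0..(n + k) div 4. ?b i * gleason1 x y ^ (n + k - 4 * i) * gleason2 x y ^ i)" for x y
  proof -
    have "gleason1 x y ^ k * f x y =
        (\<Sum>i = 0..n div 4. ?b i * gleason1 x y ^ (n + k - 4 * i) * gleason2 x y ^ i)"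
      unfolding a sum_distrib_left
    proof (rule sum.cong)
      fix i assume "i \<in> {0..n div 4}"
      then have "4 * i \<le> n" by auto
      then have "gleason1 x y ^ (n + k - 4 * i) = gleason1 x y ^ k * gleason1 x y ^ (n - 4 * i)"
        by (simp flip: power_add add: add.commute)
      then show "gleason1 x y ^ k * (a i * gleason1 x y ^ (n - 4 * i) * gleason2 x y ^ i)
          = ?b i * gleason1 x y ^ (n + k - 4 * i) * gleason2 x y ^ i"
        using \<open>i \<in> _\<close> by simp
    qed simp
    also have "\<dots> = (\<Sum>i = 0..(n + k) div 4. ?b i * gleason1 x y ^ (n + k - 4 * i) * gleason2 x y ^ i)"
      by (rule sum.mono_neutral_left) (auto simp: div_le_mono)
    finally show ?thesis .
  qed
  then show ?thesis unfolding gleason_poly_def by (intro exI[of _ ?b]) blast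
qed

text \<open>\<open>gleason2\<close> has degree 8, so half the degree grows by 4 and every index
  \<open>i\<close> moves up by one.\<close>

lemma gleason_poly_mult2:
  assumes "gleason_poly n f"
  shows "gleason_poly (n + 4) (\<lambda>x y. gleason2 x y * f x y)"
proof -
  from assms obtain a where a:
    "\<And>x y. f x y = (\<Sum>i = 0..n div 4. a i * gleason1 x y ^ (n - 4 * i) * gleason2 x y ^ i)"
    unfolding gleason_poly_def by blast
  let ?b = "\<lambda>i. case i of 0 \<Rightarrow> 0 | Suc j \<Rightarrow> a j"
  have "gleason2 x y * f x y =
      (\<Sum>i = 0..(n + 4) div 4. ?b i * gleason1 x y ^ (n + 4 - 4 * i) * gleason2 x y ^ i)" for x y
    unfolding a sum_distrib_left
    by (simp add: sum.atLeast0_atMost_Suc_shift algebra_simps del: sum.cl_ivl_Suc)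
  then show ?thesis unfolding gleason_poly_def by (intro exI[of _ ?b]) blast
qed

text \<open>The real part expands to y^8 - 28 x^2 y^6 + 70 x^4 y^4 - 28 x^6 y^2 + x^8. Comparing the
  coefficients of y^8 and x^2 y^6 forces the factors -7 and 8.\<close>

lemma Re_z8: "Re (Complex y x ^ 8) = -7 * gleason1 x y ^ 4 + 8 * gleason2 x y"
proof -
  define a b where "a = x\<^sup>2" and "b = y\<^sup>2"
  define w where "w = (Complex y x ^ 2) ^ 2"
  have z2: "Complex y x ^ 2 = Complex (b - a) (2 * x * y)"
    by (simp add: complex_eq_iff power2_eq_square a_def b_def)
  have w: "Re w = (b - a)\<^sup>2 - 4 * (a * b)" "Im w = 4 * (b - a) * (x * y)"
    unfolding w_def z2 by (simp_all add: power2_eq_square a_def b_def)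
  have "Complex y x ^ 8 = w\<^sup>2"
    by (simp add: w_def flip: power_mult)
  then have "Re (Complex y x ^ 8) = (Re w)\<^sup>2 - (Im w)\<^sup>2"
    by (simp add: power2_eq_square)
  also have "(Im w)\<^sup>2 = 16 * (b - a)\<^sup>2 * (a * b)"
    by (simp only: w power_mult_distrib) (simp add: a_def b_def)
  also have "(Re w)\<^sup>2 - 16 * (b - a)\<^sup>2 * (a * b) =
      -7 * (b + a) ^ 4 + 8 * (b ^ 4 + 14 * a\<^sup>2 * b\<^sup>2 + a ^ 4)"
    unfolding w by (simp add: power2_eq_square power4_eq_xxxx algebra_simps)
  finally show ?thesis
    by (simp add: gleason1_def gleason2_def a_def b_def flip: power_mult)
qed

text \<open>For u = z^8 the Chebyshev recursion Re u^(j+2) = 2 Re u Re u^(j+1) - |u|^2 Re u^j holds,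
  because u is a root of t^2 - 2 (Re u) t + |u|^2. Both coefficients are Gleason polynomials: Re u
  by \<open>Re_z8\<close>, and |u|^2 is the eighth power of \<open>gleason1\<close>.\<close>

lemma gleason_poly_Re_z8:
  "gleason_poly (4 * j) (\<lambda>x y. Re (Complex y x ^ (8 * j)))"
proof (induction j rule: induct_nat_012)
  case 0
  show ?case by (simp add: gleason_poly_one)
next
  case 1
  have eq: "Re (Complex y x ^ (8 * Suc 0)) =
      -7 * (gleason1 x y ^ 4 * 1) + 8 * (gleason2 x y * 1)" for x y
    by (simp add: Re_z8)
  show ?case unfolding eq
    using gleason_poly_add[OF
        gleason_poly_scale[OF gleason_poly_mult1[OF gleason_poly_one, of 4], of "-7"]
        gleason_poly_scale[OF gleason_poly_mult2[OF gleason_poly_one], of 8]]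
    by simp
next
  case (ge2 j)
  let ?T = "\<lambda>j x y. Re (Complex y x ^ (8 * j))"
  have eq: "?T (Suc (Suc j)) x y =
      -14 * (gleason1 x y ^ 4 * ?T (Suc j) x y) + 16 * (gleason2 x y * ?T (Suc j) x y)
      + (-1) * (gleason1 x y ^ 8 * ?T j x y)" for x y
  proof -
    define u where "u = Complex y x ^ 8"
    have u1: "Re u = -7 * gleason1 x y ^ 4 + 8 * gleason2 x y"
      by (simp add: u_def Re_z8)
    have "(Re u)\<^sup>2 + (Im u)\<^sup>2 = (cmod (Complex y x) ^ 2) ^ 8"
      by (metis cmod_power2 norm_power power_mult u_def mult.commute)
    then have u2: "(Re u)\<^sup>2 + (Im u)\<^sup>2 = gleason1 x y ^ 8"
      by (simp add: cmod_power2 gleason1_def)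
    have rec: "Re (u ^ Suc (Suc j)) = 2 * Re u * Re (u ^ Suc j) - gleason1 x y ^ 8 * Re (u ^ j)"
      unfolding u2[symmetric] by (simp add: algebra_simps power2_eq_square)
    have T: "?T i x y = Re (u ^ i)" for i
      by (simp add: u_def power_mult)
    show ?thesis unfolding T rec u1 by (simp add: algebra_simps del: power_Suc)
  qed
  have n: "4 * Suc j + 4 = 4 * Suc (Suc j)" "4 * j + 8 = 4 * Suc (Suc j)" by simp_all
  show ?case unfolding eq
    by (intro gleason_poly_add gleason_poly_scale gleason_poly_mult1[OF ge2(2), of 4, unfolded n]
        gleason_poly_mult2[OF ge2(2), unfolded n] gleason_poly_mult1[OF ge2(1), of 8, unfolded n])
qed

text \<open>For a = n + 4j the factor (z cnj z)^(n-4j) splits off as a power of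
  \<open>gleason1\<close> and z^(8j) remains. The case a = n - 4j is the complex conjugate and has
  the same real part.\<close>

lemma gleason_poly_Re_monom:
  assumes "[a = n] (mod 4)" "a \<le> 2 * n"
  shows "gleason_poly n (\<lambda>x y. Re (Complex y x ^ a * cnj (Complex y x) ^ (2 * n - a)))"
proof -
  have *: "gleason_poly n (\<lambda>x y. Re (Complex y x ^ (n + 4 * j) * cnj (Complex y x) ^ (n - 4 * j)))"
    if j: "4 * j \<le> n" for j
  proof -
    have eq: "Re (Complex y x ^ (n + 4 * j) * cnj (Complex y x) ^ (n - 4 * j)) =
        gleason1 x y ^ (n - 4 * j) * Re (Complex y x ^ (8 * j))" for x y
    proof -
      let ?z = "Complex y x"
      have "?z ^ (n + 4 * j) = ?z ^ (n - 4 * j) * ?z ^ (8 * j)"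
        using j by (simp flip: power_add add: add.commute)
      then have "?z ^ (n + 4 * j) * cnj ?z ^ (n - 4 * j) = (?z * cnj ?z) ^ (n - 4 * j) * ?z ^ (8 * j)"
        by (simp only: power_mult_distrib mult_ac)
      also have "?z * cnj ?z = complex_of_real (gleason1 x y)"
        by (simp add: complex_eq_iff gleason1_def power2_eq_square)
      finally show ?thesis by (simp flip: of_real_power)
    qed
    show ?thesis unfolding eq
      using gleason_poly_mult1[OF gleason_poly_Re_z8[of j], of "n - 4 * j"] j by simp
  qed
  show ?thesis
  proof (cases "n \<le> a")
    case True
    with assms(1) obtain j where "a = j * 4 + n"
      by (auto simp: cong_le_nat)
    then have "a = n + 4 * j" by simp
    then show ?thesis using *[of j] assms(2) by simp
  next
    case False
    with cong_sym[OF assms(1)] obtain j where "n = j * 4 + a"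
      by (auto simp: cong_le_nat)
    then have j: "n = a + 4 * j" by simp
    have "Re (Complex y x ^ a * cnj (Complex y x) ^ (2 * n - a)) =
      Re (Complex y x ^ (n + 4 * j) * cnj (Complex y x) ^ (n - 4 * j))" for x y
    proof -
      have "a = n - 4 * j" "2 * n - a = n + 4 * j" using j by auto
      then have "Complex y x ^ a * cnj (Complex y x) ^ (2 * n - a) =
        cnj (Complex y x ^ (n + 4 * j) * cnj (Complex y x) ^ (n - 4 * j))" by simp
      then show ?thesis by (simp only: cnj.sel)
    qed
    then show ?thesis using *[of j] j by simp
  qed
qed

text \<open>Forms of degree \<open>N\<close> in \<open>z\<close> and \<open>cnj z\<close>, as
  functions. This basis is chosen because its monomials are eigenvectors of all rotations of the
  plane.\<close>

definition z_poly :: "nat \<Rightarrow> (complex \<Rightarrow> complex) \<Rightarrow> bool" where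
  "z_poly N F \<longleftrightarrow> (\<exists>d :: nat \<Rightarrow> complex. \<forall>z. F z = (\<Sum>a\<le>N. d a * (z ^ a * cnj z ^ (N - a))))"

section \<open>Closure properties of forms in \<open>z\<close> and \<open>cnj z\<close>\<close>

lemma z_poly_add: "z_poly N F \<Longrightarrow> z_poly N G \<Longrightarrow> z_poly N (\<lambda>z. F z + G z)"
  unfolding z_poly_def
  by (elim exE, rule_tac x = "\<lambda>a. d a + da a" in exI) (simp add: sum.distrib distrib_right)

lemma z_poly_scale: "z_poly N F \<Longrightarrow> z_poly N (\<lambda>z. c * F z)"
  unfolding z_poly_def
  by (elim exE, rule_tac x = "\<lambda>a. c * d a" in exI) (simp add: sum_distrib_left mult.assoc)

lemma z_poly_zero: "z_poly N (\<lambda>z. 0)"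
  unfolding z_poly_def by (rule exI[of _ "\<lambda>_. 0"]) simp

lemma z_poly_sum:
  assumes "\<And>i. i \<in> I \<Longrightarrow> z_poly N (F i)"
  shows "z_poly N (\<lambda>z. \<Sum>i\<in>I. F i z)"
  using assms
  by (induction I rule: infinite_finite_induct) (simp_all add: z_poly_zero z_poly_add)

lemma z_poly_mult_z:
  assumes "z_poly N F"
  shows "z_poly (Suc N) (\<lambda>z. z * F z)"
proof -
  from assms obtain d where d: "\<And>z. F z = (\<Sum>a\<le>N. d a * (z ^ a * cnj z ^ (N - a)))"
    unfolding z_poly_def by blast
  have "z * F z = (\<Sum>a\<le>Suc N. (case a of 0 \<Rightarrow> 0 | Suc b \<Rightarrow> d b) * (z ^ a * cnj z ^ (Suc N - a)))" for z
    unfolding d sum_distrib_left sum.atMost_Suc_shift by (simp add: algebra_simps)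
  then show ?thesis unfolding z_poly_def by (intro exI[of _ "case_nat 0 d"]) blast
qed

lemma z_poly_mult_cnj:
  assumes "z_poly N F"
  shows "z_poly (Suc N) (\<lambda>z. cnj z * F z)"
proof -
  from assms obtain d where d: "\<And>z. F z = (\<Sum>a\<le>N. d a * (z ^ a * cnj z ^ (N - a)))"
    unfolding z_poly_def by blast
  have "cnj z * F z = (\<Sum>a\<le>Suc N. (if a \<le> N then d a else 0) * (z ^ a * cnj z ^ (Suc N - a)))" for z
    unfolding d sum_distrib_left by (simp add: algebra_simps Suc_diff_le)
  then show ?thesis unfolding z_poly_def
    by (intro exI[of _ "\<lambda>a. if a \<le> N then d a else 0"]) blast
qed

lemma z_poly_mult_Re:
  assumes F: "z_poly N F"
  shows "z_poly (Suc N) (\<lambda>z. of_real (Re z) * F z)"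
proof -
  have eq: "of_real (Re z) = 1 / 2 * (z + cnj z)" for z
    by (simp add: complex_eq_iff)
  have "of_real (Re z) * F z = 1 / 2 * (z * F z + cnj z * F z)" for z
    unfolding eq by (simp only: distrib_right mult.assoc)
  then show ?thesis
    by (simp only:) (intro z_poly_scale z_poly_add z_poly_mult_z z_poly_mult_cnj F)
qed

lemma z_poly_mult_Im: "z_poly N F \<Longrightarrow> z_poly (Suc N) (\<lambda>z. of_real (Im z) * F z)"
proof -
  assume F: "z_poly N F"
  have eq: "of_real (Im z) = 1 / (2 * \<i>) * (z + (- 1) * cnj z)" for z
    by (simp add: complex_eq_iff)
  have "of_real (Im z) * F z = 1 / (2 * \<i>) * (z * F z + (- 1) * (cnj z * F z))" for z
    unfolding eq by (simp only: distrib_right mult.assoc)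
  then show ?thesis
    by (simp only:) (intro z_poly_scale z_poly_add z_poly_mult_z z_poly_mult_cnj F)
qed

text \<open>\<open>Re z\<close> and \<open>Im z\<close> are linear in \<open>z\<close> and
  \<open>cnj z\<close>. With x = Im z and y = Re z this covers every monomial of a weight
  enumerator.\<close>

lemma z_poly_monom: "z_poly (w + v) (\<lambda>z. of_real (Im z) ^ w * of_real (Re z) ^ v)"
proof (induction w)
  case 0
  show ?case
  proof (induction v)
    case 0
    show ?case unfolding z_poly_def by (rule exI[of _ "\<lambda>_. 1"]) simp
  next
    case (Suc v)
    then show ?case using z_poly_mult_Re[OF Suc] by simp
  qed
next
  case (Suc w)
  then show ?case using z_poly_mult_Im[OF Suc] by (simp add: mult.assoc)
qed

text \<open>The base equals \<i>^(a-n), a fourth root of unity; its four powers cancel unless it is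
  1.\<close>

lemma sum_powers_fourth_root:
  "(\<Sum>k<4. (\<i> ^ a * (- \<i>) ^ n) ^ k) = (if [a = n] (mod 4) then 4 else 0)"
proof -
  have "u ^ m = u ^ (m mod 4)" if "u ^ 4 = 1" for u :: complex and m
    by (metis mult_div_mod_eq mult_1 power_add power_mult power_one that)
  from this[of "\<i>" a] this[of "- \<i>" n]
  have eq: "\<i> ^ a * (- \<i>) ^ n = \<i> ^ (a mod 4) * (- \<i>) ^ (n mod 4)"
    by (simp add: power4_eq_xxxx)
  define p q where "p = a mod 4" and "q = n mod 4"
  have "p = 0 \<or> p = 1 \<or> p = 2 \<or> p = 3" "q = 0 \<or> q = 1 \<or> q = 2 \<or> q = 3"
    unfolding p_def q_def by linarith+
  then have "(\<Sum>k<4. (\<i> ^ p * (- \<i>) ^ q) ^ k) = (if p = q then 4 else 0)"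
    by (elim disjE) (simp_all add: eval_nat_numeral)
  then show ?thesis
    unfolding eq cong_def p_def q_def .
qed

text \<open>The two invariances generate a rotation by an eighth of a turn. Averaging over its
  powers keeps the monomials with a congruent to n modulo 4, and conjugation symmetry then reduces
  them to the real parts handled by \<open>gleason_poly_Re_monom\<close>.\<close>

theorem gleason_type_I:
  fixes f :: "real \<Rightarrow> real \<Rightarrow> real"
  assumes poly: "z_poly (2 * n) (\<lambda>z. of_real (f (Im z) (Re z)))"
    and even: "\<And>x y. f (- x) y = f x y"
    and dual: "\<And>x y. f ((y - x) / sqrt 2) ((y + x) / sqrt 2) = f x y"
  shows "gleason_poly n f"
proof -
  define F where "F = (\<lambda>z. complex_of_real (f (Im z) (Re z)))"
  define M where "M = (\<lambda>a z. z ^ a * cnj z ^ (2 * n - a))"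
  obtain d where d: "\<And>z. F z = (\<Sum>a\<le>2 * n. d a * M a z)"
    using poly unfolding z_poly_def F_def M_def by blast
  define \<zeta> where "\<zeta> = Complex (1 / sqrt 2) (1 / sqrt 2)"
  have zeta: "\<zeta>\<^sup>2 = \<i>" "(cnj \<zeta>)\<^sup>2 = - \<i>" "\<zeta> * cnj \<zeta> = 1"
    by (simp_all add: \<zeta>_def complex_eq_iff power2_eq_square)
  \<comment> \<open>Multiplication by \<zeta> is the reflection x -> -x followed by the MacWilliams
    transform.\<close>
  have rot1: "F (\<zeta> * z) = F z" for z
  proof -
    have "f ((Re z + Im z) / sqrt 2) ((Re z - Im z) / sqrt 2) = f (Im z) (Re z)"
      using dual[of "Re z" "- Im z"] even by simp
    then show ?thesis
      by (simp add: F_def \<zeta>_def add_divide_distrib diff_divide_distrib add.commute)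
  qed
  have rot: "F (\<zeta> ^ k * z) = F z" for k z
    by (induction k arbitrary: z) (simp_all add: rot1 mult.assoc)
  have M_rot: "M a (\<zeta> ^ k * z) = (\<i> ^ a * (- \<i>) ^ n) ^ k * M a z" if "a \<le> 2 * n" for a k z
  proof -
    \<comment> \<open>Inserting the factor \<zeta> \<open>cnj\<close> \<zeta> = 1 to the power
      \<open>a\<close> turns the exponents into \<open>2 * a\<close> and \<open>2 * n\<close>, so
      only the squares \<i> and -\<i> appear.\<close>
    have "\<zeta> ^ a * cnj \<zeta> ^ (2 * n - a) = \<zeta> ^ a * (\<zeta> * cnj \<zeta>) ^ a * cnj \<zeta> ^ (2 * n - a)"
      by (simp add: zeta)
    also have "\<dots> = (\<zeta> ^ a * \<zeta> ^ a) * (cnj \<zeta> ^ a * cnj \<zeta> ^ (2 * n - a))"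
      by (simp only: power_mult_distrib mult_ac)
    also have "\<dots> = (\<zeta>\<^sup>2) ^ a * ((cnj \<zeta>)\<^sup>2) ^ n"
      using that by (simp flip: power_add power_mult add: mult_2)
    finally have "\<zeta> ^ a * cnj \<zeta> ^ (2 * n - a) = \<i> ^ a * (- \<i>) ^ n"
      by (simp only: zeta)
    moreover have "M a (\<zeta> ^ k * z) = (\<zeta> ^ a * cnj \<zeta> ^ (2 * n - a)) ^ k * M a z"
      by (simp add: M_def power_mult_distrib mult_ac flip: power_mult)
    ultimately show ?thesis by simp
  qed
  define I where "I = {a. a \<le> 2 * n \<and> [a = n] (mod 4)}"
  have F: "F z = (\<Sum>a\<in>I. d a * M a z)" for z
  proof -
    \<comment> \<open>Although \<zeta> has order 8, four powers suffice: the fourth power -1 acts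
      trivially in the even degree \<open>2 * n\<close>.\<close>
    have "4 * F z = (\<Sum>k<4. F (\<zeta> ^ k * z))"
      by (simp add: rot)
    also have "\<dots> = (\<Sum>k<4. \<Sum>a\<le>2 * n. d a * M a z * (\<i> ^ a * (- \<i>) ^ n) ^ k)"
      unfolding d
    proof (intro sum.cong refl)
      fix k a assume "a \<in> {..2 * n}"
      then show "d a * M a (\<zeta> ^ k * z) = d a * M a z * (\<i> ^ a * (- \<i>) ^ n) ^ k"
        using M_rot[of a k z] by simp
    qed
    also have "\<dots> = (\<Sum>a\<le>2 * n. d a * M a z * (\<Sum>k<4. (\<i> ^ a * (- \<i>) ^ n) ^ k))"
      by (subst sum.swap) (simp only: sum_distrib_left)
    also have "\<dots> = (\<Sum>a\<le>2 * n. if [a = n] (mod 4) then 4 * (d a * M a z) else 0)"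
      unfolding sum_powers_fourth_root by (intro sum.cong) auto
    also have "\<dots> = 4 * (\<Sum>a\<in>I. d a * M a z)"
      unfolding sum_distrib_left I_def by (subst sum.inter_filter[symmetric]) (simp_all add: atMost_def)
    finally show ?thesis by simp
  qed
  have f: "f x y = (\<Sum>a\<in>I. Re (d a) * Re (M a (Complex y x)))" for x y
  proof -
    define z where "z = Complex y x"
    \<comment> \<open>Evenness in x is invariance under conjugation of z; symmetrising leaves only
      the real parts of the coefficients.\<close>
    have "2 * f x y = Re (F z + F (cnj z))"
      by (simp add: F_def z_def even)
    also have "\<dots> = (\<Sum>a\<in>I. Re (d a * M a z) + Re (d a * cnj (M a z)))"
      unfolding F by (simp add: sum.distrib M_def)
    also have "\<dots> = (\<Sum>a\<in>I. 2 * (Re (d a) * Re (M a z)))"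
      by (intro sum.cong) simp_all
    finally show ?thesis by (simp add: z_def flip: sum_distrib_left)
  qed
  have "gleason_poly n (\<lambda>x y. \<Sum>a\<in>I. Re (d a) * Re (M a (Complex y x)))"
    unfolding M_def
    by (intro gleason_poly_sum gleason_poly_scale gleason_poly_Re_monom) (simp_all add: I_def)
  then show ?thesis by (simp flip: f)
qed

section \<open>Codes in standard form\<close>

text \<open>Rewriting bit arithmetic to bitwise operations or to cardinalities would block ring reasoning.\<close>

declare add_bit_eq_xor [simp del] mult_bit_eq_and [simp del] sum_of_bool_eq [simp del]

section \<open>Bit arithmetic and row spaces\<close>

lemma bit_add_self [simp]: "a + a = 0" for a :: bit
  by (cases a) (simp_all add: add_bit_eq_xor)

lemma bit_add_eq_0_iff: "a + b = 0 \<longleftrightarrow> a = b" for a b :: bit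
  by (cases a; cases b) simp_all

lemma bit_eq_of_bool: "a = of_bool (a \<noteq> 0)" for a :: bit
  by (cases a) simp_all

lemma code_of_eq: "code_of G = (\<lambda>y. G\<^sup>T *\<^sub>v y) ` carrier_vec (dim_row G)"
  unfolding code_of_def
  by (subst vec_space.row_space_eq[of G "dim_row G"]) (auto intro: carrier_vecI)

lemma code_of_carrier: "code_of G \<subseteq> carrier_vec (dim_col G)"
  by (auto simp: code_of_eq intro: carrier_vecI)

lemma index_transpose_mult_vec:
  "j < dim_col G \<Longrightarrow> y \<in> carrier_vec (dim_row G) \<Longrightarrow>
   (G\<^sup>T *\<^sub>v y) $ j = (\<Sum>i<dim_row G. G $$ (i, j) * y $ i)"
  by (auto simp: scalar_prod_def atLeast0LessThan intro!: sum.cong)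

lemma code_of_add:
  assumes "u \<in> code_of G" "v \<in> code_of G"
  shows "u + v \<in> code_of G"
proof -
  from assms obtain y z where "y \<in> carrier_vec (dim_row G)" "u = G\<^sup>T *\<^sub>v y"
    "z \<in> carrier_vec (dim_row G)" "v = G\<^sup>T *\<^sub>v z"
    by (auto simp: code_of_eq)
  then show ?thesis
    unfolding code_of_eq
    by (intro image_eqI[of _ _ "y + z"])
       (auto simp: mult_add_distrib_mat_vec[where nr = "dim_col G" and nc = "dim_row G"])
qed

text \<open>Combining the complemented rows with coefficients \<open>y\<close> adds
  \<open>s y\<close> times the all-ones word, which is the sum of the rows of \<open>G\<close>. This
  equals combining the rows of \<open>G\<close> with coefficients \<open>\<phi> y\<close>. As
  \<open>n\<close> is even, \<open>\<phi>\<close> preserves \<open>s\<close> and is an involution,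
  so the same words arise.\<close>

lemma code_of_complement:
  assumes G: "dim_row G = n" "even n"
    and ones: "\<And>j. j < dim_col G \<Longrightarrow> (\<Sum>i<n. G $$ (i, j)) = 1"
  shows "code_of (mat n (dim_col G) (\<lambda>(i, j). 1 + G $$ (i, j))) = code_of G"
proof -
  let ?G' = "mat n (dim_col G) (\<lambda>(i, j). 1 + G $$ (i, j))"
  define s :: "bit vec \<Rightarrow> bit" where "s y = (\<Sum>i<n. y $ i)" for y
  define \<phi> where "\<phi> y = vec n (\<lambda>i. y $ i + s y)" for y
  have \<phi>: "\<phi> y \<in> carrier_vec n" for y by (simp add: \<phi>_def)
  have word: "?G'\<^sup>T *\<^sub>v y = G\<^sup>T *\<^sub>v \<phi> y" if y: "y \<in> carrier_vec n" for y
  proof (rule eq_vecI)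
    fix j assume "j < dim_vec (G\<^sup>T *\<^sub>v \<phi> y)"
    then have j: "j < dim_col G" by simp
    have "(?G'\<^sup>T *\<^sub>v y) $ j = (\<Sum>i<n. (1 + G $$ (i, j)) * y $ i)"
      using j y by (subst index_transpose_mult_vec) (auto intro!: sum.cong)
    also have "\<dots> = s y + (\<Sum>i<n. G $$ (i, j) * y $ i)"
      by (simp only: s_def distrib_right mult_1 sum.distrib)
    also have "\<dots> = (\<Sum>i<n. G $$ (i, j) * y $ i) + (\<Sum>i<n. G $$ (i, j)) * s y"
      by (simp only: ones[OF j] mult_1 add.commute)
    also have "\<dots> = (\<Sum>i<n. G $$ (i, j) * (y $ i + s y))"
      by (simp only: distrib_left sum.distrib sum_distrib_right)
    also have "\<dots> = (G\<^sup>T *\<^sub>v \<phi> y) $ j"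
      using j G \<phi> by (subst index_transpose_mult_vec) (auto simp: \<phi>_def intro!: sum.cong)
    finally show "(?G'\<^sup>T *\<^sub>v y) $ j = (G\<^sup>T *\<^sub>v \<phi> y) $ j" .
  qed simp
  have s\<phi>: "s (\<phi> y) = s y" for y
  proof -
    have "s (\<phi> y) = (\<Sum>i<n. y $ i + s y)"
      unfolding s_def[of "\<phi> y"] by (intro sum.cong) (simp_all add: \<phi>_def)
    also have "\<dots> = s y + of_nat n * s y"
      by (simp add: sum.distrib s_def)
    also have "(of_nat n :: bit) = 0"
      using \<open>even n\<close> by (auto elim!: evenE)
    finally show ?thesis by simp
  qed
  have inv: "\<phi> (\<phi> y) = y" if "y \<in> carrier_vec n" for y
  proof (rule eq_vecI)
    fix i assume "i < dim_vec y"
    then show "\<phi> (\<phi> y) $ i = y $ i"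
      using that s\<phi>[of y] by (simp add: \<phi>_def[of "\<phi> y"]) (simp add: \<phi>_def add.assoc)
  qed (use that in \<open>simp add: \<phi>_def\<close>)
  have "(carrier_vec n :: bit vec set) = \<phi> ` carrier_vec n"
  proof (intro equalityI subsetI)
    fix y :: "bit vec" assume "y \<in> carrier_vec n"
    then have "y = \<phi> (\<phi> y)" by (simp only: inv)
    then show "y \<in> \<phi> ` carrier_vec n" using \<phi> by (rule image_eqI)
  qed (use \<phi> in auto)
  then have "(\<lambda>y. G\<^sup>T *\<^sub>v y) ` carrier_vec n = (\<lambda>y. G\<^sup>T *\<^sub>v y) ` \<phi> ` carrier_vec n"
    by (rule arg_cong)
  also have "\<dots> = (\<lambda>y. G\<^sup>T *\<^sub>v \<phi> y) ` carrier_vec n"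
    by (rule image_image)
  also have "\<dots> = (\<lambda>y. ?G'\<^sup>T *\<^sub>v y) ` carrier_vec n"
    by (intro image_cong refl) (simp only: word)
  finally show ?thesis
    by (simp add: code_of_eq G)
qed

lemma hamming_weight_append: "hamming_weight (u @\<^sub>v v) = hamming_weight u + hamming_weight v"
proof -
  let ?S = "\<lambda>w :: bit vec. {i. i < dim_vec w \<and> w $ i \<noteq> 0}"
  have split: "?S (u @\<^sub>v v) = ?S u \<union> (\<lambda>i. dim_vec u + i) ` ?S v" (is "?L = ?R")
  proof (rule Set.set_eqI)
    fix i show "i \<in> ?L \<longleftrightarrow> i \<in> ?R"
    proof (cases "i < dim_vec u")
      case False
      then obtain j where "i = dim_vec u + j" by (metis le_iff_add not_less)
      then show ?thesis by auto
    qed auto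
  qed
  show ?thesis
    unfolding hamming_weight_def split
    by (subst card_Un_disjoint) (auto simp: card_image)
qed

lemma of_nat_hamming_weight: "(of_nat (hamming_weight v) :: bit) = (\<Sum>i<dim_vec v. v $ i)"
proof -
  have "(\<Sum>i<dim_vec v. v $ i) = (\<Sum>i<dim_vec v. of_bool (v $ i \<noteq> 0))"
    by (intro sum.cong refl) (rule bit_eq_of_bool)
  also have "\<dots> = of_nat (card ({..<dim_vec v} \<inter> {i. v $ i \<noteq> 0}))"
    by (rule sum_of_bool_eq) simp_all
  also have "{..<dim_vec v} \<inter> {i. v $ i \<noteq> 0} = {i. i < dim_vec v \<and> v $ i \<noteq> 0}"
    by auto
  finally show ?thesis by (simp only: hamming_weight_def)
qed

section \<open>Generator matrices with an identity block\<close>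

lemma transpose_standard_mult_vec:
  fixes A :: "bit mat"
  assumes A: "A \<in> carrier_mat n m" and y: "y \<in> carrier_vec n"
  shows "(append_cols (1\<^sub>m n) A)\<^sup>T *\<^sub>v y = y @\<^sub>v (A\<^sup>T *\<^sub>v y)"
proof (rule eq_vecI)
  let ?G = "append_cols (1\<^sub>m n) A"
  fix j assume "j < dim_vec (y @\<^sub>v (A\<^sup>T *\<^sub>v y))"
  then have j: "j < n + m" using A y by simp
  have "(?G\<^sup>T *\<^sub>v y) $ j = col ?G j \<bullet> y" using j A by simp
  also have "col ?G j = (if j < n then unit_vec n j else col A (j - n))"
    using j A by (intro eq_vecI) (auto simp: index_append_cols)
  finally show "(?G\<^sup>T *\<^sub>v y) $ j = (y @\<^sub>v (A\<^sup>T *\<^sub>v y)) $ j"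
    using j A y by auto
qed (use A y in auto)

lemma code_of_standard:
  assumes A: "A \<in> carrier_mat n m"
  shows "code_of (append_cols (1\<^sub>m n) A) = (\<lambda>y. y @\<^sub>v (A\<^sup>T *\<^sub>v y)) ` carrier_vec n"
  unfolding code_of_eq using transpose_standard_mult_vec[OF A] by (auto intro: image_cong)

lemma card_code_of_standard:
  assumes A: "A \<in> carrier_mat n m"
  shows "card (code_of (append_cols (1\<^sub>m n) A)) = 2 ^ n"
proof -
  have "inj_on (\<lambda>y. y @\<^sub>v (A\<^sup>T *\<^sub>v y)) (carrier_vec n)"
    by (rule inj_onI) (auto simp: append_vec_eq)
  then show ?thesis
    by (simp add: code_of_standard[OF A] card_image card_carrier_vec_bit)
qed

text \<open>The identity block makes the rows both pairwise distinct and independent. Distinctness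
  matters because the span is taken over the set of rows, which must have \<open>n\<close>
  elements.\<close>

lemma linear_code_standard:
  assumes A: "A \<in> carrier_mat n m"
  shows "linear_code (n + m) n (code_of (append_cols (1\<^sub>m n) A))"
proof -
  let ?G = "append_cols (1\<^sub>m n) A"
  interpret vec_space "TYPE(bit)" "n + m" .
  have G: "dim_row ?G = n" "dim_col ?G = n + m" using A by auto
  then have GT: "?G\<^sup>T \<in> carrier_mat (n + m) n" by auto
  have code: "code_of ?G = span (set (cols ?G\<^sup>T))"
    unfolding code_of_def G(2) row_space_def by simp
  have sub: "set (cols ?G\<^sup>T) \<subseteq> carrier_vec (n + m)"
    using cols_dim[of "?G\<^sup>T"] A by simp
  have kernel: "y = 0\<^sub>v n" if "y \<in> carrier_vec n" "?G\<^sup>T *\<^sub>v y = 0\<^sub>v (n + m)" for y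
  proof -
    have eq: "y @\<^sub>v (A\<^sup>T *\<^sub>v y) = 0\<^sub>v (n + m)"
      using that transpose_standard_mult_vec[OF A] by simp
    show ?thesis
    proof (rule eq_vecI)
      fix i assume "i < dim_vec (0\<^sub>v n :: bit vec)"
      then show "y $ i = 0\<^sub>v n $ i"
        using arg_cong[OF eq, of "\<lambda>v. v $ i"] that(1) A by simp
    qed (use that in simp)
  qed
  have "distinct (cols ?G\<^sup>T)"
    unfolding distinct_conv_nth
  proof (intro allI impI notI)
    fix i j assume ij: "i < length (cols ?G\<^sup>T)" "j < length (cols ?G\<^sup>T)" "i \<noteq> j"
      and eq: "cols ?G\<^sup>T ! i = cols ?G\<^sup>T ! j"
    from ij have "i < n" "j < n" by simp_all
    with eq have "row ?G i $ i = row ?G j $ i" by simp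
    then show False
      using \<open>i < n\<close> \<open>j < n\<close> \<open>i \<noteq> j\<close> A by (simp add: index_append_cols)
  qed
  moreover from this have "lin_indpt (set (cols ?G\<^sup>T))"
    using lin_depE[OF GT] kernel by metis
  ultimately have "rank ?G\<^sup>T = n"
    using lin_indpt_full_rank[OF GT] by blast
  then show ?thesis
    unfolding linear_code_def code
    using span_is_subspace[OF sub] by (simp add: rank_def)
qed

text \<open>The inner product of (y | A^T y) with (v | w) is y . (v + A w). It vanishes for all unit
  vectors y exactly if v = A w, as signs do not matter over F_2.\<close>

lemma dual_code_standard:
  assumes A: "A \<in> carrier_mat n m"
  shows "dual_code (n + m) (code_of (append_cols (1\<^sub>m n) A)) = (\<lambda>w. (A *\<^sub>v w) @\<^sub>v w) ` carrier_vec m"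
proof -
  have ip: "(y @\<^sub>v (A\<^sup>T *\<^sub>v y)) \<bullet> (v @\<^sub>v w) = y \<bullet> (v + A *\<^sub>v w)"
    if "y \<in> carrier_vec n" "v \<in> carrier_vec n" "w \<in> carrier_vec m" for y v w
  proof -
    have "(y @\<^sub>v (A\<^sup>T *\<^sub>v y)) \<bullet> (v @\<^sub>v w) = y \<bullet> v + (A\<^sup>T *\<^sub>v y) \<bullet> w"
      using that A by (intro scalar_prod_append) auto
    also have "(A\<^sup>T *\<^sub>v y) \<bullet> w = y \<bullet> (A *\<^sub>v w)"
      using that A by (intro transpose_vec_mult_scalar) auto
    also have "y \<bullet> v + y \<bullet> (A *\<^sub>v w) = y \<bullet> (v + A *\<^sub>v w)"
      using that A by (intro scalar_prod_add_distrib[symmetric]) auto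
    finally show ?thesis .
  qed
  show ?thesis
  proof (intro equalityI subsetI)
    fix c assume "c \<in> dual_code (n + m) (code_of (append_cols (1\<^sub>m n) A))"
    then have c: "c \<in> carrier_vec (n + m)"
      and orth: "\<And>y. y \<in> carrier_vec n \<Longrightarrow> (y @\<^sub>v (A\<^sup>T *\<^sub>v y)) \<bullet> c = 0"
      by (auto simp: dual_code_def code_of_standard[OF A])
    define v w where "v = vec_first c n" and "w = vec_last c m"
    have vw: "v \<in> carrier_vec n" "w \<in> carrier_vec m" "c = v @\<^sub>v w"
      using c by (auto simp: v_def w_def)
    have "v = A *\<^sub>v w"
    proof (rule eq_vecI)
      fix i assume "i < dim_vec (A *\<^sub>v w)"
      then have i: "i < n" using A by simp
      have "(v + A *\<^sub>v w) $ i = unit_vec n i \<bullet> (v + A *\<^sub>v w)"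
        using i vw A by (intro scalar_prod_left_unit[symmetric]) auto
      also have "\<dots> = 0"
        using orth[of "unit_vec n i"] ip[of "unit_vec n i" v w] vw by simp
      finally show "v $ i = (A *\<^sub>v w) $ i"
        using i A by (simp add: bit_add_eq_0_iff)
    qed (use A vw in auto)
    then show "c \<in> (\<lambda>w. (A *\<^sub>v w) @\<^sub>v w) ` carrier_vec m"
      using vw by auto
  next
    fix c assume "c \<in> (\<lambda>w. (A *\<^sub>v w) @\<^sub>v w) ` carrier_vec m"
    then obtain w where w: "w \<in> carrier_vec m" "c = (A *\<^sub>v w) @\<^sub>v w" by auto
    have "A *\<^sub>v w + A *\<^sub>v w = 0\<^sub>v n"
      using A by (intro eq_vecI) auto
    then have "(y @\<^sub>v (A\<^sup>T *\<^sub>v y)) \<bullet> c = 0" if "y \<in> carrier_vec n" for y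
      using ip[OF that, of "A *\<^sub>v w" w] that w A by simp
    then show "c \<in> dual_code (n + m) (code_of (append_cols (1\<^sub>m n) A))"
      using w A by (auto simp: dual_code_def code_of_standard[OF A])
  qed
qed

lemma hamming_weight_permute:
  assumes p: "bij_betw p {..<n} {..<n}" and u: "u \<in> carrier_vec n" and v: "v \<in> carrier_vec n"
    and eq: "\<And>i. i < n \<Longrightarrow> v $ i = u $ p i"
  shows "hamming_weight v = hamming_weight u"
proof -
  have "bij_betw p {i \<in> {..<n}. v $ i \<noteq> 0} {i \<in> {..<n}. u $ i \<noteq> 0}"
    by (rule bij_betw_Collect[OF p]) (simp add: eq)
  then show ?thesis
    using u v by (auto simp: hamming_weight_def dest: bij_betw_same_card)
qed

text \<open>The assumption says that \<open>A\<close> is its own transpose up to permutations of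
  rows and columns. If the coordinates of \<open>w\<close> are permuted by \<open>p\<close>, then
  A^T applied to the result is A w permuted by \<open>q\<close>, so the code word (\<pi> w | A^T
  \<pi> w) and the dual word (A w | w) have equal weight.\<close>

lemma weight_enum_dual_isodual:
  assumes A: "A \<in> carrier_mat n n"
    and p: "bij_betw p {..<n} {..<n}" and q: "bij_betw q {..<n} {..<n}"
    and A_eq: "\<And>i j. i < n \<Longrightarrow> j < n \<Longrightarrow> A $$ (i, j) = A $$ (q j, p i)"
  shows "weight_enum (n + n) (dual_code (n + n) (code_of (append_cols (1\<^sub>m n) A))) x y =
         weight_enum (n + n) (code_of (append_cols (1\<^sub>m n) A)) x y"
proof -
  define m where "m k = x ^ k * y ^ (n + n - k)" for k
  define \<pi> where "\<pi> w = vec n (\<lambda>i. w $ p i)" for w :: "bit vec"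
  have \<pi>: "\<pi> w \<in> carrier_vec n" for w by (simp add: \<pi>_def)
  define p' where "p' = the_inv_into {..<n} p"
  have p': "p' (p i) = i" "p (p' i) = i" "p i < n" "p' i < n" if "i < n" for i
    using p that bij_betw_the_inv_into[OF p]
    by (auto simp: p'_def the_inv_into_f_f f_the_inv_into_f bij_betw_def)
  have bij: "bij_betw \<pi> (carrier_vec n) (carrier_vec n)"
    by (rule bij_betw_byWitness[where f' = "\<lambda>w. vec n (\<lambda>i. w $ p' i)"])
       (auto simp: \<pi>_def p' intro!: eq_vecI)
  have wt: "hamming_weight (\<pi> w @\<^sub>v (A\<^sup>T *\<^sub>v \<pi> w)) = hamming_weight ((A *\<^sub>v w) @\<^sub>v w)"
    if w: "w \<in> carrier_vec n" for w
  proof -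
    have "hamming_weight (\<pi> w) = hamming_weight w"
      by (rule hamming_weight_permute[OF p w \<pi>]) (simp add: \<pi>_def)
    moreover have "hamming_weight (A\<^sup>T *\<^sub>v \<pi> w) = hamming_weight (A *\<^sub>v w)"
    proof (rule hamming_weight_permute[OF q])
      fix j assume j: "j < n"
      have qj: "q j < n" using q j by (auto simp: bij_betw_def)
      have "(A\<^sup>T *\<^sub>v \<pi> w) $ j = (\<Sum>i<n. A $$ (i, j) * \<pi> w $ i)"
        using index_transpose_mult_vec[of j A "\<pi> w"] A j \<pi> by auto
      also have "\<dots> = (\<Sum>i<n. A $$ (q j, p i) * w $ p i)"
        using j by (intro sum.cong) (simp_all add: A_eq \<pi>_def)
      also have "\<dots> = (\<Sum>i<n. A $$ (q j, i) * w $ i)"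
        by (rule sum.reindex_bij_betw[OF p])
      also have "\<dots> = (A *\<^sub>v w) $ q j"
        using A w qj by (auto simp: scalar_prod_def atLeast0LessThan intro!: sum.cong)
      finally show "(A\<^sup>T *\<^sub>v \<pi> w) $ j = (A *\<^sub>v w) $ q j" .
    qed (use A w in \<open>auto intro: carrier_vecI\<close>)
    ultimately show ?thesis by (simp add: hamming_weight_append)
  qed
  have inj1: "inj_on (\<lambda>w. (A *\<^sub>v w) @\<^sub>v w) (carrier_vec n)"
    using A by (intro inj_onI) (subst (asm) append_vec_eq[where n = n], auto)
  have inj2: "inj_on (\<lambda>w. w @\<^sub>v (A\<^sup>T *\<^sub>v w)) (carrier_vec n)"
    by (intro inj_onI) (auto simp: append_vec_eq)
  have "weight_enum (n + n) (dual_code (n + n) (code_of (append_cols (1\<^sub>m n) A))) x y =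
      (\<Sum>w\<in>carrier_vec n. m (hamming_weight ((A *\<^sub>v w) @\<^sub>v w)))"
    unfolding weight_enum_def dual_code_standard[OF A] m_def
    by (simp add: sum.reindex[OF inj1])
  also have "\<dots> = (\<Sum>w\<in>carrier_vec n. m (hamming_weight (\<pi> w @\<^sub>v (A\<^sup>T *\<^sub>v \<pi> w))))"
    by (intro sum.cong refl) (simp only: wt)
  also have "\<dots> = (\<Sum>w\<in>carrier_vec n. m (hamming_weight (w @\<^sub>v (A\<^sup>T *\<^sub>v w))))"
    by (rule sum.reindex_bij_betw[OF bij])
  also have "\<dots> = weight_enum (n + n) (code_of (append_cols (1\<^sub>m n) A)) x y"
    unfolding weight_enum_def code_of_standard[OF A] m_def
    by (simp add: sum.reindex[OF inj2])
  finally show ?thesis .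
qed

text \<open>Since the rows of \<open>A\<close> have odd weight, y and A^T y have weights of equal
  parity.\<close>

lemma even_hamming_weight_standard:
  assumes A: "A \<in> carrier_mat n m"
    and rows: "\<And>i. i < n \<Longrightarrow> (\<Sum>j<m. A $$ (i, j)) = 1"
    and c: "c \<in> code_of (append_cols (1\<^sub>m n) A)"
  shows "even (hamming_weight c)"
proof -
  obtain y where y: "y \<in> carrier_vec n" "c = y @\<^sub>v (A\<^sup>T *\<^sub>v y)"
    using c by (auto simp: code_of_standard[OF A])
  have "(of_nat (hamming_weight (A\<^sup>T *\<^sub>v y)) :: bit) = (\<Sum>j<m. \<Sum>i<n. A $$ (i, j) * y $ i)"
    unfolding of_nat_hamming_weight using A y
    by (intro sum.cong) (auto simp: index_transpose_mult_vec simp del: index_mult_mat_vec)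
  also have "\<dots> = (\<Sum>i<n. (\<Sum>j<m. A $$ (i, j)) * y $ i)"
    by (subst sum.swap) (simp only: sum_distrib_right)
  also have "\<dots> = (\<Sum>i<n. y $ i)"
    by (intro sum.cong) (simp_all add: rows)
  also have "\<dots> = of_nat (hamming_weight y)"
    using y by (simp add: of_nat_hamming_weight)
  finally have "(of_nat (hamming_weight c) :: bit) = 0"
    by (simp add: y hamming_weight_append)
  then show ?thesis
    by (metis even_of_nat_iff dvd_0_right)
qed

lemma weight_enum_homogeneous:
  assumes "C \<subseteq> carrier_vec N"
  shows "weight_enum N C (x / s) (y / s) = weight_enum N C x y / s ^ N"
  unfolding weight_enum_def sum_divide_distrib
proof (rule sum.cong)
  fix c assume "c \<in> C"
  then have "hamming_weight c \<le> N" using assms hamming_weight_le by blast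
  then have "s ^ N = s ^ hamming_weight c * s ^ (N - hamming_weight c)"
    by (simp flip: power_add)
  then show "(x / s) ^ hamming_weight c * (y / s) ^ (N - hamming_weight c) =
      x ^ hamming_weight c * y ^ (N - hamming_weight c) / s ^ N"
    by (simp add: power_divide)
qed simp

text \<open>Even weights give invariance under x -> -x, and the MacWilliams identity gives
  invariance under the transform.\<close>

theorem gleason_formally_self_dual_even:
  assumes C: "C \<subseteq> carrier_vec (2 * n)" "\<And>u v. u \<in> C \<Longrightarrow> v \<in> C \<Longrightarrow> u + v \<in> C"
    and card: "card C = 2 ^ n"
    and even: "\<And>c. c \<in> C \<Longrightarrow> even (hamming_weight c)"
    and fsd: "\<And>x y. weight_enum (2 * n) (dual_code (2 * n) C) x y = weight_enum (2 * n) C x y"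
  shows "gleason_poly n (weight_enum (2 * n) C)"
proof (rule gleason_type_I)
  show "z_poly (2 * n) (\<lambda>z. complex_of_real (weight_enum (2 * n) C (Im z) (Re z)))"
    unfolding weight_enum_def of_real_sum of_real_mult of_real_power
  proof (rule z_poly_sum)
    fix c assume "c \<in> C"
    then have "hamming_weight c + (2 * n - hamming_weight c) = 2 * n"
      using C(1) hamming_weight_le[of c "2 * n"] by auto
    then show "z_poly (2 * n) (\<lambda>z. complex_of_real (Im z) ^ hamming_weight c *
        complex_of_real (Re z) ^ (2 * n - hamming_weight c))"
      by (metis z_poly_monom)
  qed
  show "weight_enum (2 * n) C (- x) y = weight_enum (2 * n) C x y" for x y
    unfolding weight_enum_def by (intro sum.cong) (simp_all add: even)
  show "weight_enum (2 * n) C ((y - x) / sqrt 2) ((y + x) / sqrt 2) = weight_enum (2 * n) C x y" for x y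
  proof -
    have "weight_enum (2 * n) C ((y - x) / sqrt 2) ((y + x) / sqrt 2) =
        real (card C) * weight_enum (2 * n) C x y / sqrt 2 ^ (2 * n)"
      by (simp only: weight_enum_homogeneous[OF C(1)] macwilliams[OF C] fsd)
    \<comment> \<open>The size 2^n of the code cancels against the normalising factor (sqrt
      2)^(2n).\<close>
    then show ?thesis by (simp add: card power_mult)
  qed
qed

section \<open>The codes of the inclusion matrices\<close>

lemma bij_betw_nth_subs: "bij_betw ((!) (subs m N)) {..<N choose m} {S. S \<subseteq> {..<N} \<and> card S = m}"
  by (rule bij_betw_nth) (simp_all add: distinct_subs set_subs)

lemma card_index_subs:
  "card {j. j < N choose m \<and> P (subs m N ! j)} = card {T. T \<subseteq> {..<N} \<and> card T = m \<and> P T}"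
proof -
  have "bij_betw ((!) (subs m N)) {j \<in> {..<N choose m}. P (subs m N ! j)}
      {T \<in> {S. S \<subseteq> {..<N} \<and> card S = m}. P T}"
    by (rule bij_betw_Collect[OF bij_betw_nth_subs]) simp
  then show ?thesis by (simp add: bij_betw_same_card)
qed

lemma card_supersets:
  assumes "finite U" "S \<subseteq> U" "card S = m"
  shows "card {T. T \<subseteq> U \<and> card T = Suc m \<and> S \<subseteq> T} = card U - m"
proof -
  have fin: "finite S" using assms by (metis finite_subset)
  have "{T. T \<subseteq> U \<and> card T = Suc m \<and> S \<subseteq> T} = (\<lambda>x. insert x S) ` (U - S)"
  proof (intro equalityI subsetI)
    fix T assume "T \<in> {T. T \<subseteq> U \<and> card T = Suc m \<and> S \<subseteq> T}"
    then have T: "T \<subseteq> U" "card T = Suc m" "S \<subseteq> T" by auto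
    then have "card (T - S) = 1"
      using assms fin by (simp add: card_Diff_subset)
    then obtain x where "T - S = {x}" by (auto simp: card_1_singleton_iff)
    then show "T \<in> (\<lambda>x. insert x S) ` (U - S)" using T by (intro image_eqI[of _ _ x]) auto
  qed (use assms fin in auto)
  moreover have "inj_on (\<lambda>x. insert x S) (U - S)"
    by (rule inj_onI) blast
  ultimately show ?thesis
    using assms fin by (simp add: card_image card_Diff_subset)
qed

lemma card_subsets_of_subset:
  assumes "finite T" "T \<subseteq> U" "card T = Suc m"
  shows "card {S. S \<subseteq> U \<and> card S = m \<and> S \<subseteq> T} = Suc m"
proof -
  have "{S. S \<subseteq> U \<and> card S = m \<and> S \<subseteq> T} = {S. S \<subseteq> T \<and> card S = m}"
    using assms by auto
  then show ?thesis using assms by (simp add: n_subsets)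
qed

lemma incl_mat_row_weight:
  assumes "i < N choose m"
  shows "card {j. j < N choose Suc m \<and> subs m N ! i \<subseteq> subs (Suc m) N ! j} = N - m"
  using card_supersets[of "{..<N}" "subs m N ! i" m] nth_subs[OF assms]
  by (simp add: card_index_subs)

lemma incl_mat_col_weight:
  assumes "j < N choose Suc m"
  shows "card {i. i < N choose m \<and> subs m N ! i \<subseteq> subs (Suc m) N ! j} = Suc m"
  using card_subsets_of_subset[of "subs (Suc m) N ! j" "{..<N}" m] nth_subs[OF assms]
    finite_subset[of "subs (Suc m) N ! j" "{..<N}"]
  by (simp add: card_index_subs[where P = "\<lambda>S. S \<subseteq> subs (Suc m) N ! j"])

lemma incl_mat_row_sum:
  assumes "i < N choose m"
  shows "(\<Sum>j<N choose Suc m. incl_mat 0 m N $$ (i, j)) = of_nat (N - m)"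
proof -
  have "(\<Sum>j<N choose Suc m. incl_mat 0 m N $$ (i, j)) =
      (\<Sum>j<N choose Suc m. of_bool (subs m N ! i \<subseteq> subs (Suc m) N ! j))"
    using assms by (intro sum.cong) (simp_all add: incl_mat_def)
  also have "\<dots> = of_nat (card ({..<N choose Suc m} \<inter> {j. subs m N ! i \<subseteq> subs (Suc m) N ! j}))"
    by (rule sum_of_bool_eq) simp_all
  also have "{..<N choose Suc m} \<inter> {j. subs m N ! i \<subseteq> subs (Suc m) N ! j} =
      {j. j < N choose Suc m \<and> subs m N ! i \<subseteq> subs (Suc m) N ! j}"
    by auto
  finally show ?thesis by (simp only: incl_mat_row_weight[OF assms])
qed

lemma incl_mat_col_sum:
  assumes "j < N choose Suc m"
  shows "(\<Sum>i<N choose m. incl_mat 0 m N $$ (i, j)) = of_nat (Suc m)"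
proof -
  have "(\<Sum>i<N choose m. incl_mat 0 m N $$ (i, j)) =
      (\<Sum>i<N choose m. of_bool (subs m N ! i \<subseteq> subs (Suc m) N ! j))"
    using assms by (intro sum.cong) (simp_all add: incl_mat_def)
  also have "\<dots> = of_nat (card ({..<N choose m} \<inter> {i. subs m N ! i \<subseteq> subs (Suc m) N ! j}))"
    by (rule sum_of_bool_eq) simp_all
  also have "{..<N choose m} \<inter> {i. subs m N ! i \<subseteq> subs (Suc m) N ! j} =
      {i. i < N choose m \<and> subs m N ! i \<subseteq> subs (Suc m) N ! j}"
    by auto
  finally show ?thesis by (simp only: incl_mat_col_weight[OF assms])
qed

text \<open>Complementation of sets, transported to the positions in the two subset lists.\<close>

lemma subs_complement:
  assumes "m \<le> N"
  obtains p where "bij_betw p {..<N choose m} {..<N choose (N - m)}"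
    "\<And>i. i < N choose m \<Longrightarrow> subs (N - m) N ! p i = {..<N} - subs m N ! i"
proof -
  let ?X = "\<lambda>m. {S. S \<subseteq> {..<N} \<and> card S = m}"
  let ?nth = "(!) (subs (N - m) N)"
  have card_compl: "card ({..<N} - S) = N - card S" if "S \<subseteq> {..<N}" for S
    using that finite_subset[OF that] by (simp add: card_Diff_subset)
  have compl: "bij_betw (\<lambda>S. {..<N} - S) (?X m) (?X (N - m))"
    by (rule bij_betw_byWitness[where f' = "\<lambda>S. {..<N} - S"])
       (use assms in \<open>auto simp: card_compl double_diff\<close>)
  define p where "p = the_inv_into {..<N choose (N - m)} ?nth \<circ> ((\<lambda>S. {..<N} - S) \<circ> (!) (subs m N))"
  have 1: "bij_betw ((\<lambda>S. {..<N} - S) \<circ> (!) (subs m N)) {..<N choose m} (?X (N - m))"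
    by (rule bij_betw_trans[OF bij_betw_nth_subs compl])
  show ?thesis
  proof
    show "bij_betw p {..<N choose m} {..<N choose (N - m)}"
      unfolding p_def
      by (rule bij_betw_trans[OF 1 bij_betw_the_inv_into[OF bij_betw_nth_subs]])
    fix i assume "i < N choose m"
    then have "{..<N} - subs m N ! i \<in> ?X (N - m)"
      using bij_betwE[OF 1] by auto
    then show "subs (N - m) N ! p i = {..<N} - subs m N ! i"
      unfolding p_def o_def by (rule f_the_inv_into_f_bij_betw[OF bij_betw_nth_subs])
  qed
qed

text \<open>Complementation reverses inclusion, and on \<open>2 * m + 1\<close> points it exchanges
  the \<open>m\<close>-subsets with the \<open>Suc m\<close>-subsets. It therefore carries rows to
  columns and columns to rows.\<close>

lemma incl_mat_isodual:
  assumes N: "N = 2 * m + 1" and n: "n = N choose m"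
  obtains p q where "bij_betw p {..<n} {..<n}" "bij_betw q {..<n} {..<n}"
    "\<And>i j. i < n \<Longrightarrow> j < n \<Longrightarrow> incl_mat e m N $$ (i, j) = incl_mat e m N $$ (q j, p i)"
proof -
  have diff: "N - m = Suc m" "N - Suc m = m" using N by simp_all
  have n': "N choose Suc m = n"
    using binomial_symmetric[of m N] N n diff by simp
  obtain p where p: "bij_betw p {..<n} {..<n}"
    "\<And>i. i < n \<Longrightarrow> subs (Suc m) N ! p i = {..<N} - subs m N ! i"
    using subs_complement[of m N] N n n' diff by auto
  obtain q where q: "bij_betw q {..<n} {..<n}"
    "\<And>j. j < n \<Longrightarrow> subs m N ! q j = {..<N} - subs (Suc m) N ! j"
    using subs_complement[of "Suc m" N] N n n' diff by auto
  have "incl_mat e m N $$ (i, j) = incl_mat e m N $$ (q j, p i)" if "i < n" "j < n" for i j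
  proof -
    have "p i < n" "q j < n" using p(1) q(1) that by (auto simp: bij_betw_def)
    moreover have "subs m N ! i \<subseteq> {..<N}" "subs (Suc m) N ! j \<subseteq> {..<N}"
      using nth_subs[of i N m] nth_subs[of j N "Suc m"] that n n' by auto
    then have "subs m N ! i \<subseteq> subs (Suc m) N ! j \<longleftrightarrow>
        {..<N} - subs (Suc m) N ! j \<subseteq> {..<N} - subs m N ! i"
      by blast
    ultimately show ?thesis
      using that by (simp add: incl_mat_def n' p(2) q(2) flip: n)
  qed
  with p(1) q(1) that show ?thesis by blast
qed

text \<open>Pascal's rule leaves two terms. By absorption \<open>2 * m choose m\<close> is twice a
  binomial coefficient, and with l = m - 1 the product of l and \<open>2 * m choose l\<close> is
  even while l is odd.\<close>

lemma even_central_binomial: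
  assumes "even m" "0 < m"
  shows "even ((2 * m + 1) choose m)"
proof -
  obtain l where l: "m = Suc l" using assms by (cases m) auto
  have "Suc l * (2 * m choose Suc l) = 2 * m * ((2 * m - 1) choose l)"
    by (rule binomial_absorption)
  then have "(2 * m choose m) = 2 * ((2 * m - 1) choose l)"
    using l by (metis (no_types, opaque_lifting) mult.assoc mult.left_commute mult_cancel1 nat.distinct(1))
  moreover have "even (2 * m choose l)"
  proof -
    obtain r where r: "l = Suc r" using assms l by (cases l) auto
    have "Suc r * (2 * m choose Suc r) = 2 * m * ((2 * m - 1) choose r)"
      by (rule binomial_absorption)
    then have "even (l * (2 * m choose l))" unfolding r by simp
    then show ?thesis using assms l by simp
  qed
  moreover have "(2 * m + 1) choose m = (2 * m choose l) + (2 * m choose m)"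
    by (simp add: l)
  ultimately show ?thesis by simp
qed

section \<open>Ingredients of the distance bound\<close>

lemma min_dist_le:
  assumes "u \<in> C" "0\<^sub>v N \<in> C" "u \<noteq> 0\<^sub>v N" "u \<in> carrier_vec N"
  shows "min_dist C \<le> hamming_weight u"
proof -
  have "hamming_dist u (0\<^sub>v N) = hamming_weight u"
    using assms(4) unfolding hamming_dist_def hamming_weight_def
    by (intro arg_cong[where f = card]) auto
  then have "hamming_weight u \<in> {hamming_dist u v | u v. u \<in> C \<and> v \<in> C \<and> u \<noteq> v}"
    using assms(1-3) by force
  then show ?thesis unfolding min_dist_def by (rule cInf_lower) simp
qed

lemma n0_add_2: "n0 (m + 2) = (2 * m + 1) choose m"
proof -
  have "2 * (m + 2) - 3 = 2 * m + 1" by simp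
  then show ?thesis by (simp add: n0_def)
qed

text \<open>Binomial coefficients grow towards the middle of the row, so the one at \<open>m\<close>
  is at least the one at 2. Quadratic growth is enough against a distance that is linear in
  \<open>m\<close>.\<close>

lemma central_binomial_ge:
  assumes "2 \<le> m"
  shows "(2 * m + 1) * m \<le> (2 * m + 1) choose m"
proof -
  have "(2 * m + 1) choose 2 \<le> (2 * m + 1) choose m"
    using assms by (intro binomial_mono) simp_all
  then show ?thesis by (simp add: choose_two)
qed

(* M_truc 2 is the zero matrix (0 | 0): its code is the zero code, neither a [2,1] code nor
   equal in weight enumerator to the code of L_truc 2, and it has no minimum distance.
   The claims about the code of M_truc are therefore restricted to k \<noteq> 2. *)
theorem theorem7p6:
  fixes k :: nat
  assumes "k > 0" and "even k"
  shows "linear_code (2 * n0 k) (n0 k) (code_of (L_truc k))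
    \<and> (k \<noteq> 2 \<longrightarrow> linear_code (2 * n0 k) (n0 k) (code_of (M_truc k)))
    \<and> (\<exists>a :: nat \<Rightarrow> real. \<forall>x y.
         weight_enum (2 * n0 k) (code_of (L_truc k)) x y
           = (\<Sum>i = 0..n0 k div 4. a i * gleason1 x y ^ (n0 k - 4 * i) * gleason2 x y ^ i)
         \<and> (k \<noteq> 2 \<longrightarrow>
              weight_enum (2 * n0 k) (code_of (M_truc k)) x y
                = weight_enum (2 * n0 k) (code_of (L_truc k)) x y))
    \<and> (k \<noteq> 2 \<longrightarrow> min_dist (code_of (M_truc k)) = min_dist (code_of (L_truc k)))
    \<and> (n0 k \<le> 30 \<longrightarrow> min_dist (code_of (L_truc k)) \<le> 2 * (n0 k div 4) + 2)
    \<and> (n0 k \<ge> 32 \<longrightarrow> min_dist (code_of (L_truc k)) \<le> 2 * (n0 k div 4))"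
proof -
  \<comment> \<open>A positive even \<open>k\<close> is at least 2, so nothing is truncated; the
    ground set has \<open>2 * m + 1\<close>, that is 2k - 3, points.\<close>
  define m where "m = k - 2"
  have k: "k = m + 2" and m: "even m"
    using assms by (auto simp: m_def elim!: evenE)
  define n where "n = n0 k"
  define N where "N = 2 * m + 1"
  have n: "n = N choose m" by (simp only: n_def k n0_add_2 N_def)
  have n': "N choose Suc m = n"
    using binomial_symmetric[of m N] by (simp add: n N_def)
  have "0 < n" unfolding n by (simp add: zero_less_binomial_iff N_def)
  define A where "A = incl_mat 0 m N"
  have A: "A \<in> carrier_mat n n"
    by (rule carrier_matI) (simp_all add: A_def n n' flip: n)
  define C where "C = code_of (L_truc k)"
  have "A_mat (k - 1) (k - 2) = A" "B_mat (k - 1) (k - 2) = incl_mat 1 m N"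
    by (simp_all add: A_mat_eq B_mat_eq k A_def N_def mult_2)
  then have L: "L_truc k = append_cols (1\<^sub>m n) A"
    and M: "M_truc k = append_cols (J_mat n) (incl_mat 1 m N)"
    by (simp_all add: L_truc_def M_truc_def n_def)
  have dimL: "dim_row (L_truc k) = n" "dim_col (L_truc k) = n + n"
    using A by (simp_all add: L)
  have C_std: "C = code_of (append_cols (1\<^sub>m n) A)"
    by (simp add: C_def L)
  have C_sub: "C \<subseteq> carrier_vec (n + n)"
    using code_of_carrier[of "L_truc k"] by (simp add: C_def dimL)
  have C_eq: "C = (\<lambda>y. y @\<^sub>v (A\<^sup>T *\<^sub>v y)) ` carrier_vec n"
    unfolding C_std by (rule code_of_standard[OF A])
  \<comment> \<open>Both the row weight \<open>N - m\<close> and the column weight of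
    \<open>A\<close> are \<open>Suc m\<close>, which is odd.\<close>
  have odd: "(of_nat (Suc m) :: bit) = 1" and NM: "N - m = Suc m"
    using m by (auto simp: N_def elim!: evenE)
  have rows: "(\<Sum>j<n. A $$ (i, j)) = 1" if "i < n" for i
    unfolding A_def by (rule incl_mat_row_sum[of i N m, folded n, unfolded n' NM odd, OF that])
  have cols: "(\<Sum>i<n. A $$ (i, j)) = 1" if "j < n" for j
    unfolding A_def by (rule incl_mat_col_sum[of j N m, folded n, unfolded n' odd, OF that])
  have lin: "linear_code (2 * n) n C"
    using linear_code_standard[OF A] by (simp add: C_std mult_2)

  have M_code: "code_of (M_truc k) = C" if "k \<noteq> 2"
  proof -
    \<comment> \<open>Here \<open>k \<noteq> 2\<close> enters: for \<open>k = 2\<close> the order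
      \<open>n\<close> is 1.\<close>
    have "even n" unfolding n N_def
      using m that k by (intro even_central_binomial) auto
    have "M_truc k = mat n (dim_col (L_truc k)) (\<lambda>(i, j). 1 + L_truc k $$ (i, j))"
    proof (rule eq_matI)
      fix i j assume "i < dim_row (mat n (dim_col (L_truc k)) (\<lambda>(i, j). 1 + L_truc k $$ (i, j)))"
        "j < dim_col (mat n (dim_col (L_truc k)) (\<lambda>(i, j). 1 + L_truc k $$ (i, j)))"
      then have "i < n" "j < n + n" by (simp_all add: dimL)
      then show "M_truc k $$ (i, j) =
          mat n (dim_col (L_truc k)) (\<lambda>(i, j). 1 + L_truc k $$ (i, j)) $$ (i, j)"
        using A n n' by (auto simp: dimL L M index_append_cols A_def incl_mat_def
            simp flip: diag_mat_plus_1) (auto simp: diag_mat_plus_def)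
    qed (simp_all add: M dimL n' flip: diag_mat_plus_1)
    moreover have "(\<Sum>i<n. L_truc k $$ (i, j)) = 1" if "j < n + n" for j
    proof (cases "j < n")
      case True
      have "(\<Sum>i<n. L_truc k $$ (i, j)) = (\<Sum>i<n. if i = j then 1 else 0)"
        using True A by (intro sum.cong) (simp_all add: L index_append_cols)
      then show ?thesis using True by simp
    next
      case False
      have "(\<Sum>i<n. L_truc k $$ (i, j)) = (\<Sum>i<n. A $$ (i, j - n))"
        using False A that by (intro sum.cong) (simp_all add: L index_append_cols)
      then show ?thesis using False that by (simp add: cols)
    qed
    ultimately show ?thesis
      using code_of_complement[OF dimL(1) \<open>even n\<close>] by (simp add: dimL C_def)
  qed

  have gleason: "gleason_poly n (weight_enum (2 * n) C)"
  proof (rule gleason_formally_self_dual_even)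
    show "C \<subseteq> carrier_vec (2 * n)" using C_sub by (simp add: mult_2)
    show "u + v \<in> C" if "u \<in> C" "v \<in> C" for u v
      using that unfolding C_def by (rule code_of_add)
    show "card C = 2 ^ n" unfolding C_std by (rule card_code_of_standard[OF A])
    show "even (hamming_weight c)" if "c \<in> C" for c
      using even_hamming_weight_standard[OF A rows] that by (simp add: C_std)
    obtain p q where "bij_betw p {..<n} {..<n}" "bij_betw q {..<n} {..<n}"
      "\<And>i j. i < n \<Longrightarrow> j < n \<Longrightarrow> A $$ (i, j) = A $$ (q j, p i)"
      unfolding A_def using incl_mat_isodual[OF N_def n] by metis
    then show "weight_enum (2 * n) (dual_code (2 * n) C) x y = weight_enum (2 * n) C x y" for x y
      unfolding C_std mult_2 by (rule weight_enum_dual_isodual[OF A])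
  qed

  have dist: "min_dist C \<le> m + 2"
  proof -
    \<comment> \<open>The first row of the generator matrix: weight 1 in the identity block and
      \<open>m + 1\<close> in \<open>A\<close>, hence \<open>k\<close> in total.\<close>
    define e where "e = unit_vec n 0 @\<^sub>v (A\<^sup>T *\<^sub>v unit_vec n 0)"
    have e: "e \<in> C" unfolding C_eq e_def by (intro imageI) simp
    have "0\<^sub>v n @\<^sub>v (A\<^sup>T *\<^sub>v 0\<^sub>v n) = 0\<^sub>v (n + n)"
      using A by (intro eq_vecI) auto
    then have z: "0\<^sub>v (n + n) \<in> C"
      unfolding C_eq by (intro image_eqI[of _ _ "0\<^sub>v n"]) simp_all
    have "e $ 0 = 1" using \<open>0 < n\<close> by (simp add: e_def)
    then have "e \<noteq> 0\<^sub>v (n + n)" using \<open>0 < n\<close> by auto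
    then have "min_dist C \<le> hamming_weight e"
      using min_dist_le[OF e z] e C_sub by blast
    also have "hamming_weight e = hamming_weight (unit_vec n 0) + hamming_weight (A\<^sup>T *\<^sub>v unit_vec n 0)"
      by (simp add: e_def hamming_weight_append)
    also have "hamming_weight (unit_vec n 0) = card {0 :: nat}"
      unfolding hamming_weight_def using \<open>0 < n\<close>
      by (intro arg_cong[where f = card]) (auto split: if_splits)
    also have "hamming_weight (A\<^sup>T *\<^sub>v unit_vec n 0) = N - m"
    proof -
      have "(A\<^sup>T *\<^sub>v unit_vec n 0) $ j = of_bool (subs m N ! 0 \<subseteq> subs (Suc m) N ! j)" if "j < n" for j
        using that \<open>0 < n\<close> A by (simp add: A_def incl_mat_def n' flip: n)
      then have "{j. j < dim_vec (A\<^sup>T *\<^sub>v unit_vec n 0) \<and> (A\<^sup>T *\<^sub>v unit_vec n 0) $ j \<noteq> 0} =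
          {j. j < N choose Suc m \<and> subs m N ! 0 \<subseteq> subs (Suc m) N ! j}"
        using A by (auto simp: n')
      then show ?thesis
        unfolding hamming_weight_def using incl_mat_row_weight[of 0 N m] \<open>0 < n\<close> n by simp
    qed
    finally show ?thesis by (simp add: N_def)
  qed
  have bounds: "m + 2 \<le> 2 * (n div 4) + 2" "32 \<le> n \<Longrightarrow> m + 2 \<le> 2 * (n div 4)"
  proof -
    \<comment> \<open>The small cases have \<open>n = 1\<close> and \<open>n = 10\<close>, both
      below 32. From \<open>m = 4\<close> on, \<open>n \<ge> 9 * m\<close> already yields the
      sharper bound.\<close>
    consider "m = 0" | "m = 2" | "4 \<le> m" using m by (auto elim!: evenE) linarith
    then have "m + 2 \<le> 2 * (n div 4) + 2 \<and> (32 \<le> n \<longrightarrow> m + 2 \<le> 2 * (n div 4))"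
    proof cases
      case 1
      then show ?thesis by (simp add: n N_def)
    next
      case 2
      then have "n = 10" by (simp add: n N_def eval_nat_numeral)
      then show ?thesis using 2 by simp
    next
      case 3
      have "9 * m \<le> (2 * m + 1) * m" using 3 by (intro mult_right_mono) simp_all
      also have "\<dots> \<le> n" using central_binomial_ge[of m] 3 by (simp add: n N_def)
      finally show ?thesis using 3 by linarith
    qed
    then show "m + 2 \<le> 2 * (n div 4) + 2" "32 \<le> n \<Longrightarrow> m + 2 \<le> 2 * (n div 4)" by auto
  qed
  show ?thesis
    using lin M_code gleason dist bounds
    unfolding n_def[symmetric] C_def[symmetric] gleason_poly_def by fastforce
qed

end
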